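(* Let $\mathbb{F}$ be any field and $X=\{x_1,\ldots,x_n\}$. There is a deterministic algorithm which, given a nonassociative noncommutative arithmetic circuit $C$ of size $s$ computing a polynomial $f\in\mathbb{F}\{X\}$ of degree $d$, decides whether $f$ is the identically zero polynomial in $\mathbb{F}\{X\}$, in time $\mathrm{poly}(s,n,d)$.
   Context: $\mathbb{F}\{X\}$ denotes the free nonassociative noncommutative polynomial ring over $\mathbb{F}$ in $X=\{x_1,\ldots,x_n\}$. Its monomials are defined recursively: $1$ is the monomial of degree $0$; each $x_i$ is a monomial of degree $1$; if $m_1,m_2$ are monomials of positive degree then $(m_1 m_2)$ is a monomial of degree $\deg m_1+\deg m_2$. Thus a monomial of positive degree is an ordered (planar) full binary tree whose leaves are labeled by variables, and different trees are different monomials (e.g. $(x_1(x_2x_1))\neq((x_1x_2)x_1)$). Polynomials are finite $\mathbb{F}$-linear combinations of monomials; multiplication is the $\mathbb{F}$-bilinear extension of $1\cdot m=m\cdot 1=m$ and $m_1\cdot m_2=(m_1m_2)$ for $m_1,m_2$ of positive degree. The degree of a nonzero polynomial is the maximal degree of a monomial with nonzero coefficient. A nonassociative noncommutative arithmetic circuit is a directed acyclic graph whose indegree-$0$ nodes are labeled by variables from $X$ or constants from $\mathbb{F}$, and whose other nodes have indegree two and are labeled $+$ or $\times$; for each $\times$ gate its two inputs are designated left and right. Each gate computes a polynomial in $\mathbb{F}\{X\}$ (inputs compute their labels, a $+$ gate computes the sum of its inputs, a $\times$ gate computes (left input)$\cdot$(right input) in $\mathbb{F}\{X\}$); one gate is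 designated as output, and the circuit computes the polynomial at the output gate. The size is the number of nodes. *)

theory Defs
  imports Main "HOL-Library.Poly_Mapping"
begin

section \<open>Free nonassociative polynomials\<close>

text \<open>
  A monomial is either the unit or a planar full binary tree with leaves labelled by variable
  indices; the unit never occurs inside a tree. The variables are \<open>x\<^sub>0, \<dots>, x\<^sub>n\<^sub>-\<^sub>1\<close>; the bound on the
  indices is imposed on circuits below.
\<close>

datatype tree = Leaf nat | Node tree tree

datatype monomial = Unit | Tree tree

fun leaves :: "tree \<Rightarrow> nat" where
  "leaves (Leaf i) = 1"
| "leaves (Node t u) = leaves t + leaves u"

fun mdegree :: "monomial \<Rightarrow> nat" where
  "mdegree Unit = 0"
| "mdegree (Tree t) = leaves t"

fun mmult :: "monomial \<Rightarrow> monomial \<Rightarrow> monomial" where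
  "mmult Unit m = m"
| "mmult m Unit = m"
| "mmult (Tree t) (Tree u) = Tree (Node t u)"

text \<open>
  Only the additive structure of \<^typ>\<open>monomial \<Rightarrow>\<^sub>0 'a\<close> is taken from the library: its
  multiplication needs an associative operation on the keys.
\<close>

type_synonym 'a npoly = "monomial \<Rightarrow>\<^sub>0 'a"

definition npoly_var :: "nat \<Rightarrow> 'a::field npoly" where
  "npoly_var i = Poly_Mapping.single (Tree (Leaf i)) 1"

definition npoly_const :: "'a::field \<Rightarrow> 'a npoly" where
  "npoly_const c = Poly_Mapping.single Unit c"

definition npoly_mult :: "'a::field npoly \<Rightarrow> 'a npoly \<Rightarrow> 'a npoly" where
  "npoly_mult p q =
     (\<Sum>m\<in>Poly_Mapping.keys p. \<Sum>m'\<in>Poly_Mapping.keys q.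
        Poly_Mapping.single (mmult m m') (Poly_Mapping.lookup p m * Poly_Mapping.lookup q m'))"

text \<open>The zero polynomial gets degree \<open>0\<close>.\<close>

definition npoly_degree :: "'a::field npoly \<Rightarrow> nat" where
  "npoly_degree p = Max (insert 0 (mdegree ` Poly_Mapping.keys p))"


section \<open>Arithmetic circuits\<close>

text \<open>
  The nodes are the positions in the list of gates. The list need not be topologically
  sorted, and the two inputs of a gate may coincide.
\<close>

datatype 'a gate = Var nat | Const 'a | Plus nat nat | Times nat nat

datatype 'a circuit = Circuit (gates: "'a gate list") (output_node: nat)

definition circuit_size :: "'a circuit \<Rightarrow> nat" where
  "circuit_size C = length (gates C)"

fun gate_inputs :: "'a gate \<Rightarrow> nat set" where
  "gate_inputs (Var i) = {}"
| "gate_inputs (Const c) = {}"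
| "gate_inputs (Plus l r) = {l, r}"
| "gate_inputs (Times l r) = {l, r}"

definition circuit_edges :: "'a circuit \<Rightarrow> (nat \<times> nat) set" where
  "circuit_edges C = {(h, g). g < circuit_size C \<and> h \<in> gate_inputs (gates C ! g)}"

definition wf_circuit :: "nat \<Rightarrow> 'a circuit \<Rightarrow> bool" where
  "wf_circuit n C \<longleftrightarrow>
     output_node C < circuit_size C \<and>
     (\<forall>g < circuit_size C. gate_inputs (gates C ! g) \<subseteq> {..<circuit_size C}) \<and>
     (\<forall>i. Var i \<in> set (gates C) \<longrightarrow> i < n) \<and>
     acyclic (circuit_edges C)"

inductive gate_computes :: "'a::field circuit \<Rightarrow> nat \<Rightarrow> 'a npoly \<Rightarrow> bool" for C where
  var: "g < circuit_size C \<Longrightarrow> gates C ! g = Var i \<Longrightarrow> gate_computes C g (npoly_var i)"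
| const: "g < circuit_size C \<Longrightarrow> gates C ! g = Const c \<Longrightarrow> gate_computes C g (npoly_const c)"
| plus: "g < circuit_size C \<Longrightarrow> gates C ! g = Plus l r \<Longrightarrow>
    gate_computes C l p \<Longrightarrow> gate_computes C r q \<Longrightarrow> gate_computes C g (p + q)"
| times: "g < circuit_size C \<Longrightarrow> gates C ! g = Times l r \<Longrightarrow>
    gate_computes C l p \<Longrightarrow> gate_computes C r q \<Longrightarrow> gate_computes C g (npoly_mult p q)"

definition circuit_computes :: "'a::field circuit \<Rightarrow> 'a npoly \<Rightarrow> bool" where
  "circuit_computes C f \<longleftrightarrow> gate_computes C (output_node C) f"

lemma gate_computes_unique:
  assumes "gate_computes C g p" "gate_computes C g q"
  shows "p = q"
  using assms
proof (induction arbitrary: q rule: gate_computes.induct)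
  case (var g i)
  from var.prems show ?case by cases (use var.hyps in auto)
next
  case (const g c)
  from const.prems show ?case by cases (use const.hyps in auto)
next
  case (plus g l r p q q0)
  from plus.prems plus.hyps(2)
  obtain p' q' where "q0 = p' + q'" "gate_computes C l p'" "gate_computes C r q'"
    by cases auto
  with plus.IH show ?case by metis
next
  case (times g l r p q q0)
  from times.prems times.hyps(2)
  obtain p' q' where "q0 = npoly_mult p' q'" "gate_computes C l p'" "gate_computes C r q'"
    by cases auto
  with times.IH show ?case by metis
qed

lemma gate_computes_ex1:
  fixes C :: "'a::field circuit"
  assumes wf: "wf_circuit n C" and g: "g < circuit_size C"
  shows "\<exists>!p. gate_computes C g p"
proof -
  let ?E = "circuit_edges C"
  have "?E \<subseteq> {..<circuit_size C} \<times> {..<circuit_size C}"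
    using wf by (auto simp: wf_circuit_def circuit_edges_def)
  then have "finite ?E"
    by (rule finite_subset) simp
  then have "wf ?E"
    using wf by (simp add: wf_circuit_def finite_acyclic_wf)
  then have "g < circuit_size C \<longrightarrow> (\<exists>p. gate_computes C g p)"
  proof (induction g rule: wf_induct_rule)
    case (less g)
    show ?case
    proof
      assume g: "g < circuit_size C"
      have *: "\<exists>p. gate_computes C h p" if "h \<in> gate_inputs (gates C ! g)" for h
        using less.IH[of h] that g wf by (auto simp: circuit_edges_def wf_circuit_def)
      show "\<exists>p. gate_computes C g p"
      proof (cases "gates C ! g")
        case (Var i)
        then show ?thesis using g by (auto intro: gate_computes.var)
      next
        case (Const c)
        then show ?thesis using g by (auto intro: gate_computes.const)
      next
        case (Plus l r)
        then show ?thesis using g *[of l] *[of r] by (auto dest: gate_computes.plus)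
      next
        case (Times l r)
        then show ?thesis using g *[of l] *[of r] by (auto dest: gate_computes.times)
      qed
    qed
  qed
  have "gate_computes C g p \<Longrightarrow> gate_computes C g q \<Longrightarrow> p = q" for p q
    by (rule gate_computes_unique)
  with \<open>g < circuit_size C \<longrightarrow> (\<exists>p. gate_computes C g p)\<close> show ?thesis
    using g by blast
qed


section \<open>Algebraic random access machines\<close>

text \<open>
  Algorithms over an arbitrary field are deterministic while-programs on a random access memory
  with finitely many arrays of natural numbers (indices, counters) and finitely many arrays of
  field elements; a program refers to an array by a fixed number. Every memory access, arithmetic
  operation, comparison and control step costs one unit, in particular every field operation and
  every zero test. Two restrictions keep the unit cost measure honest:
  \<^item> the natural numbers have addition and truncated subtraction, but no multiplication, so that
    the bit length of an index grows at most linearly with time;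
  \<^item> the only field constants are \<open>0\<close> and \<open>1\<close>, and field elements influence
    the control flow and the indices through zero tests only.
  Programs do not depend on the field: they are finite syntactic objects.
\<close>

datatype iexp =
    INum nat
  | IGet nat iexp
  | IAdd iexp iexp
  | ISub iexp iexp

datatype fexp =
    FZero
  | FOne
  | FGet nat iexp
  | FAdd fexp fexp
  | FSub fexp fexp
  | FMul fexp fexp
  | FInv fexp

datatype bexp =
    Less iexp iexp
  | IsZero fexp
  | Not bexp
  | And bexp bexp

datatype com =
    Skip
  | ISet nat iexp iexp
  | FSet nat iexp fexp
  | Seq com com
  | If bexp com com
  | While bexp com

datatype 'a state = State (imem: "nat \<Rightarrow> nat \<Rightarrow> nat") (fmem: "nat \<Rightarrow> nat \<Rightarrow> 'a")

fun ival :: "iexp \<Rightarrow> 'a state \<Rightarrow> nat" where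
  "ival (INum k) s = k"
| "ival (IGet a e) s = imem s a (ival e s)"
| "ival (IAdd e1 e2) s = ival e1 s + ival e2 s"
| "ival (ISub e1 e2) s = ival e1 s - ival e2 s"

text \<open>As usual in the library, the inverse of \<open>0\<close> is \<open>0\<close>.\<close>

fun fval :: "fexp \<Rightarrow> 'a::field state \<Rightarrow> 'a" where
  "fval FZero s = 0"
| "fval FOne s = 1"
| "fval (FGet a e) s = fmem s a (ival e s)"
| "fval (FAdd e1 e2) s = fval e1 s + fval e2 s"
| "fval (FSub e1 e2) s = fval e1 s - fval e2 s"
| "fval (FMul e1 e2) s = fval e1 s * fval e2 s"
| "fval (FInv e) s = inverse (fval e s)"

fun bval :: "bexp \<Rightarrow> 'a::field state \<Rightarrow> bool" where
  "bval (Less e1 e2) s \<longleftrightarrow> ival e1 s < ival e2 s"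
| "bval (IsZero e) s \<longleftrightarrow> fval e s = 0"
| "bval (Not b) s \<longleftrightarrow> \<not> bval b s"
| "bval (And b1 b2) s \<longleftrightarrow> bval b1 s \<and> bval b2 s"

fun icost :: "iexp \<Rightarrow> nat" where
  "icost (INum k) = 1"
| "icost (IGet a e) = icost e + 1"
| "icost (IAdd e1 e2) = icost e1 + icost e2 + 1"
| "icost (ISub e1 e2) = icost e1 + icost e2 + 1"

fun fcost :: "fexp \<Rightarrow> nat" where
  "fcost FZero = 1"
| "fcost FOne = 1"
| "fcost (FGet a e) = icost e + 1"
| "fcost (FAdd e1 e2) = fcost e1 + fcost e2 + 1"
| "fcost (FSub e1 e2) = fcost e1 + fcost e2 + 1"
| "fcost (FMul e1 e2) = fcost e1 + fcost e2 + 1"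
| "fcost (FInv e) = fcost e + 1"

fun bcost :: "bexp \<Rightarrow> nat" where
  "bcost (Less e1 e2) = icost e1 + icost e2 + 1"
| "bcost (IsZero e) = fcost e + 1"
| "bcost (Not b) = bcost b + 1"
| "bcost (And b1 b2) = bcost b1 + bcost b2 + 1"

definition iupdate :: "nat \<Rightarrow> nat \<Rightarrow> nat \<Rightarrow> 'a state \<Rightarrow> 'a state" where
  "iupdate a i v s = State ((imem s)(a := (imem s a)(i := v))) (fmem s)"

definition fupdate :: "nat \<Rightarrow> nat \<Rightarrow> 'a \<Rightarrow> 'a state \<Rightarrow> 'a state" where
  "fupdate a i v s = State (imem s) ((fmem s)(a := (fmem s a)(i := v)))"

text \<open>\<open>runs c s t s'\<close>: started in \<open>s\<close>, the program \<open>c\<close> halts in \<open>s'\<close> at total cost \<open>t\<close>.\<close>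

inductive runs :: "com \<Rightarrow> 'a::field state \<Rightarrow> nat \<Rightarrow> 'a state \<Rightarrow> bool" where
  Skip: "runs Skip s 1 s"
| ISet: "runs (ISet a e1 e2) s (icost e1 + icost e2 + 1) (iupdate a (ival e1 s) (ival e2 s) s)"
| FSet: "runs (FSet a e1 e2) s (icost e1 + fcost e2 + 1) (fupdate a (ival e1 s) (fval e2 s) s)"
| Seq: "runs c1 s1 t1 s2 \<Longrightarrow> runs c2 s2 t2 s3 \<Longrightarrow> runs (Seq c1 c2) s1 (t1 + t2) s3"
| IfTrue: "bval b s \<Longrightarrow> runs c1 s t s' \<Longrightarrow> runs (If b c1 c2) s (bcost b + 1 + t) s'"
| IfFalse: "\<not> bval b s \<Longrightarrow> runs c2 s t s' \<Longrightarrow> runs (If b c1 c2) s (bcost b + 1 + t) s'"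
| WhileFalse: "\<not> bval b s \<Longrightarrow> runs (While b c) s (bcost b + 1) s"
| WhileTrue: "bval b s1 \<Longrightarrow> runs c s1 t1 s2 \<Longrightarrow> runs (While b c) s2 t2 s3 \<Longrightarrow>
    runs (While b c) s1 (bcost b + 1 + t1 + t2) s3"

lemma runs_deterministic:
  assumes "runs c s t s'" "runs c s u s''"
  shows "t = u \<and> s' = s''"
  using assms
proof (induction arbitrary: u s'' rule: runs.induct)
  case (Skip s)
  from Skip.prems show ?case by cases auto
next
  case (ISet a e1 e2 s)
  from ISet.prems show ?case by cases auto
next
  case (FSet a e1 e2 s)
  from FSet.prems show ?case by cases auto
next
  case (Seq c1 s1 t1 s2 c2 t2 s3)
  from Seq.prems obtain u1 u2 z where "u = u1 + u2" "runs c1 s1 u1 z" "runs c2 z u2 s''"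
    by cases auto
  with Seq.IH show ?case by metis
next
  case (IfTrue b s c1 t s' c2)
  from IfTrue.prems IfTrue.hyps(1) obtain v where "u = bcost b + 1 + v" "runs c1 s v s''"
    by cases auto
  with IfTrue.IH show ?case by metis
next
  case (IfFalse b s c2 t s' c1)
  from IfFalse.prems IfFalse.hyps(1) obtain v where "u = bcost b + 1 + v" "runs c2 s v s''"
    by cases auto
  with IfFalse.IH show ?case by metis
next
  case (WhileFalse b s c)
  from WhileFalse.prems WhileFalse.hyps show ?case by cases auto
next
  case (WhileTrue b s1 c t1 s2 t2 s3)
  from WhileTrue.prems WhileTrue.hyps(1) obtain u1 u2 z
    where "u = bcost b + 1 + u1 + u2" "runs c s1 u1 z" "runs (While b c) z u2 s''"
    by cases auto
  with WhileTrue.IH show ?case by metis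
qed

text \<open>
  Input format: the integer array \<open>0\<close> holds the number of variables, the number of nodes and the
  output node; the integer arrays \<open>1\<close>, \<open>2\<close>, \<open>3\<close> hold, for each node, the kind of its gate and its
  two integer arguments (left and right input, or the index of the variable); the field array
  \<open>0\<close> holds, for each node labelled by a constant, that constant. All other cells are \<open>0\<close>.
  A program answers in cell \<open>0\<close> of the integer array \<open>0\<close>.
\<close>

fun gate_kind :: "'a gate \<Rightarrow> nat" where
  "gate_kind (Var i) = 0"
| "gate_kind (Const c) = 1"
| "gate_kind (Plus l r) = 2"
| "gate_kind (Times l r) = 3"

fun gate_arg1 :: "'a gate \<Rightarrow> nat" where
  "gate_arg1 (Var i) = i"
| "gate_arg1 (Const c) = 0"
| "gate_arg1 (Plus l r) = l"
| "gate_arg1 (Times l r) = l"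

fun gate_arg2 :: "'a gate \<Rightarrow> nat" where
  "gate_arg2 (Var i) = 0"
| "gate_arg2 (Const c) = 0"
| "gate_arg2 (Plus l r) = r"
| "gate_arg2 (Times l r) = r"

fun gate_const :: "'a::field gate \<Rightarrow> 'a" where
  "gate_const (Const c) = c"
| "gate_const _ = 0"

definition array_of :: "'b::zero list \<Rightarrow> nat \<Rightarrow> 'b" where
  "array_of xs i = (if i < length xs then xs ! i else 0)"

definition input_state :: "nat \<Rightarrow> 'a::field circuit \<Rightarrow> 'a state" where
  "input_state n C = State
     ((\<lambda>_ _. 0)
       (0 := array_of [n, circuit_size C, output_node C],
        1 := array_of (map gate_kind (gates C)),
        2 := array_of (map gate_arg1 (gates C)),
        3 := array_of (map gate_arg2 (gates C))))
     ((\<lambda>_ _. 0)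
       (0 := array_of (map gate_const (gates C))))"

definition answer :: "'a state \<Rightarrow> nat" where
  "answer s = imem s 0 0"

end

theory Submission
  imports Defs "HOL.Vector_Spaces" "HOL-Library.Function_Algebras"
begin

text \<open>
  Fix a circuit. For every tree \<open>t\<close>, the coefficients of \<open>t\<close> in the polynomials of all gates form a
  vector indexed by the gates, the column of \<open>t\<close>. The coefficient of \<open>Node t u\<close> in a product \<open>p q\<close>
  is \<open>p\<^sub>0 q\<^sub>t\<^sub>u + p\<^sub>t\<^sub>u q\<^sub>0 + p\<^sub>t q\<^sub>u\<close>, with \<open>p\<^sub>0\<close> and \<open>q\<^sub>0\<close> the constant terms. Hence the column of
  \<open>Node t u\<close> solves a linear system along the circuit and depends bilinearly on the columns of \<open>t\<close>
  and \<open>u\<close>. The span of all columns is therefore the least space that contains the columns of the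
  variables and is closed under this bilinear product; its dimension is at most the number of
  gates. An echelon basis of it is found by inserting the columns of the variables and the
  products of basis vectors until nothing new appears. The output polynomial is zero if and only
  if its constant term and the output entry of every basis vector vanish. The degree does not
  enter the running time, which is what makes the bound hold when the output polynomial is zero
  although the gates have exponential degree.
\<close>

section \<open>Running programs within a time bound\<close>

lemma imem_iupdate [simp]: "imem (iupdate a i v s) = (imem s)(a := (imem s a)(i := v))"
  and fmem_iupdate [simp]: "fmem (iupdate a i v s) = fmem s"
  and imem_fupdate [simp]: "imem (fupdate a i x s) = imem s"
  and fmem_fupdate [simp]: "fmem (fupdate a i x s) = (fmem s)(a := (fmem s a)(i := x))"
  by (simp_all add: iupdate_def fupdate_def)

text \<open>Since runs are deterministic, the existence of one suitable run is total correctness.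
  The time is bounded from above, not given exactly, so that branches of different cost can be
  joined.\<close>

definition reach :: "com \<Rightarrow> 'a::field state \<Rightarrow> nat \<Rightarrow> ('a state \<Rightarrow> bool) \<Rightarrow> bool" where
  "reach c s T Q \<longleftrightarrow> (\<exists>t s'. runs c s t s' \<and> t \<le> T \<and> Q s')"

lemma reach_mono:
  "reach c s T Q \<Longrightarrow> T \<le> T' \<Longrightarrow> (\<And>s'. Q s' \<Longrightarrow> Q' s') \<Longrightarrow> reach c s T' Q'"
  unfolding reach_def by (meson le_trans)

lemma reach_Skip: "Q s \<Longrightarrow> 1 \<le> T \<Longrightarrow> reach Skip s T Q"
  unfolding reach_def using runs.Skip by blast

lemma reach_ISet:
  "Q (iupdate a (ival e1 s) (ival e2 s) s) \<Longrightarrow> icost e1 + icost e2 + 1 \<le> T \<Longrightarrow> reach (ISet a e1 e2) s T Q"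
  unfolding reach_def using runs.ISet by blast

lemma reach_FSet:
  "Q (fupdate a (ival e1 s) (fval e2 s) s) \<Longrightarrow> icost e1 + fcost e2 + 1 \<le> T \<Longrightarrow> reach (FSet a e1 e2) s T Q"
  unfolding reach_def using runs.FSet by blast

text \<open>The postcondition of \<open>c1\<close> is itself a claim about \<open>c2\<close>, so no
  assertion between the two commands has to be named.\<close>

lemma reach_Seq:
  assumes "reach c1 s T1 (\<lambda>s'. reach c2 s' T2 Q)" "T1 + T2 \<le> T"
  shows "reach (Seq c1 c2) s T Q"
proof -
  obtain t1 s1 t2 s2 where "runs c1 s t1 s1" "t1 \<le> T1" "runs c2 s1 t2 s2" "t2 \<le> T2" "Q s2"
    using assms(1) unfolding reach_def by blast
  moreover from this have "runs (Seq c1 c2) s (t1 + t2) s2"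
    by (blast intro: runs.Seq)
  ultimately show ?thesis
    using assms(2) unfolding reach_def by (meson add_mono le_trans)
qed

lemma reach_If:
  assumes "bval b s \<Longrightarrow> reach c1 s (T - (bcost b + 1)) Q"
    and "\<not> bval b s \<Longrightarrow> reach c2 s (T - (bcost b + 1)) Q"
    and "bcost b + 1 \<le> T"
  shows "reach (If b c1 c2) s T Q"
proof (cases "bval b s")
  case True
  then obtain t s' where "runs c1 s t s'" "t \<le> T - (bcost b + 1)" "Q s'"
    using assms(1) unfolding reach_def by blast
  with True assms(3) runs.IfTrue[of b s c1 t s' c2] show ?thesis
    unfolding reach_def by (intro exI[of _ "bcost b + 1 + t"] exI[of _ s']) auto
next
  case False
  then obtain t s' where "runs c2 s t s'" "t \<le> T - (bcost b + 1)" "Q s'"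
    using assms(2) unfolding reach_def by blast
  with False assms(3) runs.IfFalse[of b s c2 t s' c1] show ?thesis
    unfolding reach_def by (intro exI[of _ "bcost b + 1 + t"] exI[of _ s']) auto
qed

section \<open>Counting loops\<close>

abbreviation (input) ivar :: "nat \<Rightarrow> iexp" where
  "ivar x \<equiv> IGet x (INum 0)"

definition For :: "nat \<Rightarrow> iexp \<Rightarrow> com \<Rightarrow> com" where
  "For x b c = Seq (ISet x (INum 0) (INum 0))
     (While (Less (ivar x) b) (Seq c (ISet x (INum 0) (IAdd (ivar x) (INum 1)))))"

text \<open>\<open>M\<close> bounds the number of passes. The constant 30 absorbs the test and the
  increment; the additional pass pays for the initialisation and the failing last test.\<close>

definition loop_cost :: "nat \<Rightarrow> nat \<Rightarrow> nat" where
  "loop_cost M T = (M + 1) * (T + 30)"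

text \<open>The invariant is required after the increment, and the body has to preserve the counter.
  The bound \<open>b\<close> is evaluated anew in each pass, so the invariant must fix its value
  \<open>N\<close>.\<close>

lemma reach_For:
  fixes s :: "'a::field state"
  assumes bound: "\<And>k s. k \<le> N \<Longrightarrow> I k s \<Longrightarrow> ival b s = N"
    and init: "I 0 (iupdate x 0 0 s)"
    and step: "\<And>k s. k < N \<Longrightarrow> I k s \<Longrightarrow> imem s x 0 = k \<Longrightarrow>
      reach c s T (\<lambda>s'. imem s' x 0 = k \<and> I (Suc k) (iupdate x 0 (Suc k) s'))"
    and final: "\<And>s. I N s \<Longrightarrow> Q s"
    and b: "icost b \<le> 10" and N: "N \<le> M"
  shows "reach (For x b c) s (loop_cost M T) Q"
proof -
  let ?W = "While (Less (ivar x) b) (Seq c (ISet x (INum 0) (IAdd (ivar x) (INum 1))))"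
  \<comment> \<open>A pass costs at most 14 for the test, \<open>T\<close> for the body and 6 for
    the increment; the final 14 is the failing test.\<close>
  have W: "reach ?W s ((N - k) * (T + 20) + 14) Q"
    if "k \<le> N" "I k s" "imem s x 0 = k" for k and s :: "'a state"
    using that
  proof (induction "N - k" arbitrary: k s)
    case 0
    then have "\<not> bval (Less (ivar x) b) s" "Q s"
      using bound[of k s] final[of s] by auto
    then show ?case
      using runs.WhileFalse[of "Less (ivar x) b" s] b
      unfolding reach_def by (intro exI[of _ "bcost (Less (ivar x) b) + 1"] exI[of _ s]) auto
  next
    case (Suc m)
    then have k: "k < N" "m = N - Suc k"
      by auto
    then have bv: "bval (Less (ivar x) b) s"
      using Suc bound[of k s] by simp
    obtain t s' where body: "runs c s t s'" "t \<le> T" "imem s' x 0 = k"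
        "I (Suc k) (iupdate x 0 (Suc k) s')"
      using step[OF k(1) Suc.prems(2,3)] unfolding reach_def by blast
    let ?s2 = "iupdate x 0 (Suc k) s'"
    have "runs (ISet x (INum 0) (IAdd (ivar x) (INum 1))) s' 6 ?s2"
      using runs.ISet[of x "INum 0" "IAdd (ivar x) (INum 1)" s'] body(3)
      by (simp add: numeral_eq_Suc)
    then have body2: "runs (Seq c (ISet x (INum 0) (IAdd (ivar x) (INum 1)))) s (t + 6) ?s2"
      by (rule runs.Seq[OF body(1)])
    obtain t' s3 where rest: "runs ?W ?s2 t' s3" "t' \<le> (N - Suc k) * (T + 20) + 14" "Q s3"
      using Suc.hyps(1)[OF k(2), of ?s2] k(1) body(4) unfolding reach_def by auto
    have "N - k = Suc (N - Suc k)"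
      using k by simp
    then show ?case
      using runs.WhileTrue[OF bv body2 rest(1)] rest(2,3) b body(2) unfolding reach_def
      by (intro exI[of _ "bcost (Less (ivar x) b) + 1 + (t + 6) + t'"] exI[of _ s3]) auto
  qed
  have "N * (T + 20) \<le> M * (T + 30)"
    using N by (intro mult_mono) auto
  then show ?thesis
    unfolding For_def
    by (intro reach_Seq[where ?T1.0 = 3 and ?T2.0 = "N * (T + 20) + 14"] reach_ISet)
       (use W[of 0 "iupdate x 0 0 s"] init in \<open>auto simp: loop_cost_def\<close>)
qed

text \<open>A frame condition on whole arrays: \<open>A\<close> lists the integer arrays and
  \<open>B\<close> the field arrays that may change.\<close>

definition same_except :: "nat set \<Rightarrow> nat set \<Rightarrow> 'a state \<Rightarrow> 'a state \<Rightarrow> bool" where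
  "same_except A B s s' \<longleftrightarrow>
     (\<forall>a. a \<notin> A \<longrightarrow> imem s' a = imem s a) \<and> (\<forall>b. b \<notin> B \<longrightarrow> fmem s' b = fmem s b)"

lemma same_except_refl [simp]: "same_except A B s s"
  by (simp add: same_except_def)

lemma same_except_trans:
  "same_except A B s s' \<Longrightarrow> same_except A' B' s' s'' \<Longrightarrow> A \<subseteq> D \<Longrightarrow> A' \<subseteq> D \<Longrightarrow> B \<subseteq> E \<Longrightarrow> B' \<subseteq> E \<Longrightarrow>
    same_except D E s s''"
  unfolding same_except_def by (metis subsetD)

lemma same_except_iupdate:
  "same_except A B s s' \<Longrightarrow> a \<in> A \<Longrightarrow> same_except A B s (iupdate a i v s')"
  by (auto simp: same_except_def)

lemma same_except_fupdate:
  "same_except A B s s' \<Longrightarrow> b \<in> B \<Longrightarrow> same_except A B s (fupdate b i v s')"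
  by (auto simp: same_except_def)

section \<open>Coefficients of products\<close>

text \<open>Only factorizations of \<open>x\<close> contribute, and pairs outside the keys
  contribute zero. So the sum over keys becomes a sum over the set \<open>S\<close> of all
  factorizations, which below has at most three elements.\<close>

lemma lookup_npoly_mult:
  assumes "finite S" and S: "\<And>m m'. (m, m') \<in> S \<longleftrightarrow> mmult m m' = x"
  shows "Poly_Mapping.lookup (npoly_mult p q) x =
    (\<Sum>(m, m')\<in>S. Poly_Mapping.lookup p m * Poly_Mapping.lookup q m')"
proof -
  let ?K = "Poly_Mapping.keys p \<times> Poly_Mapping.keys q"
  let ?F = "\<lambda>(m, m'). Poly_Mapping.lookup p m * Poly_Mapping.lookup q m'"
  have "Poly_Mapping.lookup (npoly_mult p q) x = (\<Sum>z\<in>?K. if z \<in> S then ?F z else 0)"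
    unfolding npoly_mult_def
    by (auto simp: lookup_sum sum.cartesian_product lookup_single when_def S intro!: sum.cong)
  also have "\<dots> = (\<Sum>z\<in>?K \<inter> S. ?F z)"
    by (simp add: sum.inter_restrict)
  also have "\<dots> = (\<Sum>z\<in>S. ?F z)"
    using \<open>finite S\<close> by (intro sum.mono_neutral_left) (auto simp: in_keys_iff)
  finally show ?thesis .
qed

lemma mmult_eq_Unit: "mmult m m' = Unit \<longleftrightarrow> m = Unit \<and> m' = Unit"
  by (cases m; cases m') auto

lemma mmult_eq_Leaf:
  "mmult m m' = Tree (Leaf i) \<longleftrightarrow>
     (m, m') \<in> {(Unit, Tree (Leaf i)), (Tree (Leaf i), Unit)}"
  by (cases m; cases m') auto

text \<open>A planar tree splits at its root in one way only, so beside the two factorizations with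
  \<open>Unit\<close> there is a single one. This is where the absence of associativity
  enters.\<close>

lemma mmult_eq_Node:
  "mmult m m' = Tree (Node t u) \<longleftrightarrow>
     (m, m') \<in> {(Unit, Tree (Node t u)), (Tree (Node t u), Unit), (Tree t, Tree u)}"
  by (cases m; cases m') auto

lemma lookup_npoly_mult_Unit:
  "Poly_Mapping.lookup (npoly_mult p q) Unit =
     Poly_Mapping.lookup p Unit * Poly_Mapping.lookup q Unit"
  by (subst lookup_npoly_mult[where S = "{(Unit, Unit)}"]) (auto simp: mmult_eq_Unit)

lemma lookup_npoly_mult_Leaf:
  "Poly_Mapping.lookup (npoly_mult p q) (Tree (Leaf i)) =
     Poly_Mapping.lookup p Unit * Poly_Mapping.lookup q (Tree (Leaf i)) +
     Poly_Mapping.lookup p (Tree (Leaf i)) * Poly_Mapping.lookup q Unit"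
  by (subst lookup_npoly_mult[where S = "{(Unit, Tree (Leaf i)), (Tree (Leaf i), Unit)}"])
     (auto simp: mmult_eq_Leaf)

lemma lookup_npoly_mult_Node:
  "Poly_Mapping.lookup (npoly_mult p q) (Tree (Node t u)) =
     Poly_Mapping.lookup p Unit * Poly_Mapping.lookup q (Tree (Node t u)) +
     Poly_Mapping.lookup p (Tree (Node t u)) * Poly_Mapping.lookup q Unit +
     Poly_Mapping.lookup p (Tree t) * Poly_Mapping.lookup q (Tree u)"
  by (subst lookup_npoly_mult[where S =
        "{(Unit, Tree (Node t u)), (Tree (Node t u), Unit), (Tree t, Tree u)}"])
     (auto simp: mmult_eq_Node)

section \<open>Columns of coefficients\<close>

text \<open>Vectors are functions on all of \<open>nat\<close> with pointwise operations; columns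
  and solutions are made to vanish beyond the gates, so equations on the gates determine
  them.\<close>

interpretation fv: vector_space "\<lambda>(c::'a::field) (v::nat \<Rightarrow> 'a) g. c * v g"
  by unfold_locales (auto simp: fun_eq_iff algebra_simps)

locale circuit =
  fixes n :: nat and C :: "'a::field circuit"
  assumes wf: "wf_circuit n C"
begin

definition size :: nat where "size = circuit_size C"
definition E :: "(nat \<times> nat) set" where "E = circuit_edges C"

lemma E_bound: "(h, g) \<in> E \<Longrightarrow> h < size \<and> g < size"
  using wf by (auto simp: E_def size_def circuit_edges_def wf_circuit_def)

lemma finite_E: "finite E"
  by (rule finite_subset[of _ "{..<size} \<times> {..<size}"]) (auto dest: E_bound)

lemma acyclic_E: "acyclic E"
  using wf by (simp add: wf_circuit_def E_def)

lemma wf_E: "wf E"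
  using finite_E acyclic_E by (rule finite_acyclic_wf)

lemma E_I: "g < size \<Longrightarrow> h \<in> gate_inputs (gates C ! g) \<Longrightarrow> (h, g) \<in> E"
  by (simp add: E_def size_def circuit_edges_def)

lemma inputs_E:
  "g < size \<Longrightarrow> gates C ! g = Plus l r \<Longrightarrow> (l, g) \<in> E \<and> (r, g) \<in> E"
  "g < size \<Longrightarrow> gates C ! g = Times l r \<Longrightarrow> (l, g) \<in> E \<and> (r, g) \<in> E"
  by (auto intro: E_I)

lemma inputs_bound:
  "g < size \<Longrightarrow> gates C ! g = Plus l r \<Longrightarrow> l < size \<and> r < size"
  "g < size \<Longrightarrow> gates C ! g = Times l r \<Longrightarrow> l < size \<and> r < size"
  using inputs_E E_bound by blast+

section \<open>Levels of the gates in the acyclic graph\<close>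

definition lev :: "nat \<Rightarrow> nat" where
  "lev g = card {h. (h, g) \<in> E\<^sup>+}"

lemma preds_bound: "{h. (h, g) \<in> E\<^sup>+} \<subseteq> {..<size}"
  by (auto dest!: tranclD E_bound)

text \<open>Every ancestor of \<open>h\<close> is one of \<open>g\<close>, and \<open>h\<close> is
  an ancestor of \<open>g\<close> but, by acyclicity, not of itself.\<close>

lemma lev_less: "(h, g) \<in> E \<Longrightarrow> lev h < lev g"
  unfolding lev_def
proof (rule psubset_card_mono)
  show "finite {h. (h, g) \<in> E\<^sup>+}"
    using preds_bound finite_subset by blast
  assume "(h, g) \<in> E"
  then show "{k. (k, h) \<in> E\<^sup>+} \<subset> {k. (k, g) \<in> E\<^sup>+}"
    using acyclic_E by (auto simp: acyclic_def intro: trancl_into_trancl)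
qed

lemma lev_bound: "g < size \<Longrightarrow> lev g < size"
proof -
  assume g: "g < size"
  have "{h. (h, g) \<in> E\<^sup>+} \<subset> {..<size}"
    using preds_bound[of g] acyclic_E g by (auto simp: acyclic_def)
  then have "lev g < card {..<size}"
    unfolding lev_def by (intro psubset_card_mono) auto
  then show ?thesis by simp
qed

text \<open>Locality is all that recursion along the edges and the sweeps use. It covers both the
  nonlinear recursion for constant terms and the linear systems for columns.\<close>

definition local_rhs :: "(nat \<Rightarrow> (nat \<Rightarrow> 'a) \<Rightarrow> 'a) \<Rightarrow> bool" where
  "local_rhs rhs \<longleftrightarrow>
     (\<forall>g < size. \<forall>v v'. (\<forall>h. (h, g) \<in> E \<longrightarrow> v h = v' h) \<longrightarrow> rhs g v = rhs g v')"

lemma local_rhsD: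
  "local_rhs rhs \<Longrightarrow> g < size \<Longrightarrow> (\<And>h. (h, g) \<in> E \<Longrightarrow> v h = v' h) \<Longrightarrow> rhs g v = rhs g v'"
  by (auto simp: local_rhs_def)

section \<open>Polynomials of the gates and their coefficients\<close>

definition gate_poly :: "nat \<Rightarrow> 'a npoly" where
  "gate_poly g = (THE p. gate_computes C g p)"

lemma gate_poly: "g < size \<Longrightarrow> gate_computes C g (gate_poly g)"
  unfolding gate_poly_def size_def by (rule theI') (rule gate_computes_ex1[OF wf])

lemma gate_poly_eqI: "gate_computes C g p \<Longrightarrow> gate_poly g = p"
  unfolding gate_poly_def by (blast intro: gate_computes_unique)

lemma gate_poly_rec:
  assumes "g < size"
  shows "gate_poly g = (case gates C ! g of Var i \<Rightarrow> npoly_var i | Const c \<Rightarrow> npoly_const c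
     | Plus l r \<Rightarrow> gate_poly l + gate_poly r | Times l r \<Rightarrow> npoly_mult (gate_poly l) (gate_poly r))"
proof (rule gate_poly_eqI)
  show "gate_computes C g (case gates C ! g of Var i \<Rightarrow> npoly_var i | Const c \<Rightarrow> npoly_const c
     | Plus l r \<Rightarrow> gate_poly l + gate_poly r | Times l r \<Rightarrow> npoly_mult (gate_poly l) (gate_poly r))"
  proof (cases "gates C ! g")
    case (Var i)
    then show ?thesis
      using assms by (simp add: gate_computes.var size_def)
  next
    case (Const c)
    then show ?thesis
      using assms by (simp add: gate_computes.const size_def)
  next
    case (Plus l r)
    then show ?thesis
      using assms inputs_bound(1)[OF assms Plus]
      by (simp add: gate_computes.plus gate_poly size_def[symmetric])
  next
    case (Times l r)
    then show ?thesis
      using assms inputs_bound(2)[OF assms Times]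
      by (simp add: gate_computes.times gate_poly size_def[symmetric])
  qed
qed

definition cst :: "nat \<Rightarrow> 'a" where
  "cst g = (if g < size then Poly_Mapping.lookup (gate_poly g) Unit else 0)"

definition col :: "tree \<Rightarrow> nat \<Rightarrow> 'a" where
  "col t g = (if g < size then Poly_Mapping.lookup (gate_poly g) (Tree t) else 0)"

definition cst_rhs :: "nat \<Rightarrow> (nat \<Rightarrow> 'a) \<Rightarrow> 'a" where
  "cst_rhs g v = (case gates C ! g of Var i \<Rightarrow> 0 | Const c \<Rightarrow> c | Plus l r \<Rightarrow> v l + v r
     | Times l r \<Rightarrow> v l * v r)"

text \<open>At a product gate, a factor that does not contribute to the tree contributes its
  constant term, hence the coefficients \<open>cst l\<close> and \<open>cst r\<close>. The source
  \<open>a\<close> collects what does not involve the unknown column.\<close>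

definition lin_rhs :: "(nat \<Rightarrow> 'a) \<Rightarrow> nat \<Rightarrow> (nat \<Rightarrow> 'a) \<Rightarrow> 'a" where
  "lin_rhs a g v = (case gates C ! g of Var i \<Rightarrow> a g | Const c \<Rightarrow> a g | Plus l r \<Rightarrow> v l + v r
     | Times l r \<Rightarrow> cst l * v r + cst r * v l + a g)"

lemma local_cst_rhs: "local_rhs cst_rhs"
  by (auto simp: local_rhs_def cst_rhs_def split: gate.split dest: inputs_E)

lemma local_lin_rhs: "local_rhs (lin_rhs a)"
  by (auto simp: local_rhs_def lin_rhs_def split: gate.split dest: inputs_E)

lemma cst_eq: "g < size \<Longrightarrow> cst g = cst_rhs g cst"
  by (auto dest: inputs_bound simp: cst_def cst_rhs_def gate_poly_rec[of g] npoly_var_def npoly_const_def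
      lookup_single lookup_add lookup_npoly_mult_Unit split: gate.split)

definition var_src :: "nat \<Rightarrow> nat \<Rightarrow> 'a" where
  "var_src i g = (if gates C ! g = Var i then 1 else 0)"

definition node_src :: "(nat \<Rightarrow> 'a) \<Rightarrow> (nat \<Rightarrow> 'a) \<Rightarrow> nat \<Rightarrow> 'a" where
  "node_src w w' g = (case gates C ! g of Times l r \<Rightarrow> w l * w' r | _ \<Rightarrow> 0)"

lemma col_Leaf_eq: "g < size \<Longrightarrow> col (Leaf i) g = lin_rhs (var_src i) g (col (Leaf i))"
  by (auto dest: inputs_bound simp: cst_def col_def lin_rhs_def var_src_def gate_poly_rec[of g] npoly_var_def
      npoly_const_def lookup_single lookup_add lookup_npoly_mult_Leaf when_def split: gate.split)

lemma col_Node_eq: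
  "g < size \<Longrightarrow> col (Node t u) g = lin_rhs (node_src (col t) (col u)) g (col (Node t u))"
  by (auto dest: inputs_bound simp: cst_def col_def lin_rhs_def node_src_def gate_poly_rec[of g] npoly_var_def
      npoly_const_def lookup_single lookup_add lookup_npoly_mult_Node when_def split: gate.split)

section \<open>Linear systems along the circuit\<close>

definition solve :: "(nat \<Rightarrow> 'a) \<Rightarrow> nat \<Rightarrow> 'a" where
  "solve a = wfrec E (\<lambda>v g. if g < size then lin_rhs a g v else 0)"

lemma solve_eq: "solve a g = (if g < size then lin_rhs a g (solve a) else 0)"
  unfolding solve_def
  by (subst wfrec[OF wf_E]) (auto simp: cut_apply intro: local_rhsD[OF local_lin_rhs])

lemma solve_unique:
  assumes "\<And>g. g < size \<Longrightarrow> v g = lin_rhs a g v" "\<And>g. \<not> g < size \<Longrightarrow> v g = 0"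
  shows "v = solve a"
proof
  fix g show "v g = solve a g"
  proof (induction g rule: wf_induct_rule[OF wf_E])
    case (1 g)
    then have "lin_rhs a g v = lin_rhs a g (solve a)" if "g < size"
      using that by (intro local_rhsD[OF local_lin_rhs]) auto
    then show ?case
      using assms[of g] by (simp add: solve_eq[of a g])
  qed
qed

lemma col_Leaf: "col (Leaf i) = solve (var_src i)"
  by (rule solve_unique) (rule col_Leaf_eq, auto simp: col_def)

text \<open>A tree enters larger trees only through its column. This lets finitely many vectors
  stand for all trees: \<open>col\<close> turns \<open>Node\<close> into the product
  \<open>bprod\<close> below.\<close>

lemma col_Node: "col (Node t u) = solve (node_src (col t) (col u))"
  by (rule solve_unique) (rule col_Node_eq, auto simp: col_def)

lemma solve_0: "solve 0 = 0"
  by (rule solve_unique[symmetric]) (auto simp: lin_rhs_def split: gate.split)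

text \<open>\<open>lin_rhs\<close> is linear in source and unknown together, so the sum of the
  solutions solves the system of the summed sources; uniqueness does the rest.\<close>

lemma solve_add: "solve (a + b) = solve a + solve b"
proof (rule solve_unique[symmetric])
  fix g assume "g < size"
  then show "(solve a + solve b) g = lin_rhs (a + b) g (solve a + solve b)"
    unfolding plus_fun_apply by (subst (1 2) solve_eq)
      (auto simp: lin_rhs_def algebra_simps split: gate.split)
qed (simp add: solve_eq)

lemma solve_scale: "solve (\<lambda>g. k * a g) = (\<lambda>g. k * solve a g)"
proof (rule solve_unique[symmetric])
  fix g assume "g < size"
  then show "k * solve a g = lin_rhs (\<lambda>g. k * a g) g (\<lambda>g. k * solve a g)"
    by (subst solve_eq) (auto simp: lin_rhs_def algebra_simps split: gate.split)
qed (simp add: solve_eq)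

section \<open>The bilinear product of columns\<close>

definition bprod :: "(nat \<Rightarrow> 'a) \<Rightarrow> (nat \<Rightarrow> 'a) \<Rightarrow> nat \<Rightarrow> 'a" where
  "bprod w w' = solve (node_src w w')"

lemma bprod_linear:
  "bprod 0 w' = 0" "bprod w 0 = 0"
  "bprod (u + w) w' = bprod u w' + bprod w w'" "bprod w (u' + w') = bprod w u' + bprod w w'"
  "bprod (\<lambda>g. k * w g) w' = (\<lambda>g. k * bprod w w' g)"
  "bprod w (\<lambda>g. k * w' g) = (\<lambda>g. k * bprod w w' g)"
proof -
  have "node_src 0 w' = 0" "node_src w 0 = 0"
    "node_src (u + w) w' = node_src u w' + node_src w w'"
    "node_src w (u' + w') = node_src w u' + node_src w w'"
    "node_src (\<lambda>g. k * w g) w' = (\<lambda>g. k * node_src w w' g)"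
    "node_src w (\<lambda>g. k * w' g) = (\<lambda>g. k * node_src w w' g)"
    by (auto simp: node_src_def fun_eq_iff algebra_simps split: gate.split)
  then show "bprod 0 w' = 0" "bprod w 0 = 0"
    "bprod (u + w) w' = bprod u w' + bprod w w'" "bprod w (u' + w') = bprod w u' + bprod w w'"
    "bprod (\<lambda>g. k * w g) w' = (\<lambda>g. k * bprod w w' g)"
    "bprod w (\<lambda>g. k * w' g) = (\<lambda>g. k * bprod w w' g)"
    by (simp_all only: bprod_def solve_0 solve_add solve_scale)
qed

text \<open>By bilinearity, the arguments that are sent into \<open>fv.span H\<close> form a
  subspace. This is used first for the right factor with the left one in \<open>G\<close>, then for
  the left factor.\<close>

lemma bprod_span:
  assumes G: "\<And>w w'. w \<in> G \<Longrightarrow> w' \<in> G \<Longrightarrow> bprod w w' \<in> fv.span H"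
    and w: "w \<in> fv.span G" and w': "w' \<in> fv.span G"
  shows "bprod w w' \<in> fv.span H"
proof -
  have sub: "fv.subspace {w'. bprod u w' \<in> fv.span H}" "fv.subspace {w. bprod w w' \<in> fv.span H}" for u
    by (rule fv.subspaceI; simp only: mem_Collect_eq bprod_linear fv.span_zero fv.span_add fv.span_scale)+
  have "bprod u w' \<in> fv.span H" if "u \<in> G" for u
    using w' sub(1) by (rule fv.span_induct) (rule G[OF that])
  then show ?thesis
    by (rule fv.span_induct[OF w sub(2)])
qed

abbreviation col_span :: "(nat \<Rightarrow> 'a) set" where
  "col_span \<equiv> fv.span (range col)"

lemma bprod_col_span: "w \<in> col_span \<Longrightarrow> w' \<in> col_span \<Longrightarrow> bprod w w' \<in> col_span"
  by (rule bprod_span[of "range col"]) (auto simp: bprod_def simp flip: col_Node intro: fv.span_base)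

lemma col_Leaf_ge: "n \<le> i \<Longrightarrow> col (Leaf i) = 0"
proof -
  assume "n \<le> i"
  then have "gates C ! g \<noteq> Var i" if "g < size" for g
    using wf that nth_mem[of g "gates C"] by (force simp: wf_circuit_def size_def circuit_size_def)
  \<comment> \<open>The source \<open>var_src i\<close> is known to vanish on the gates only, so
    zero is checked to be a solution instead of rewriting the source to \<open>0\<close>.\<close>
  then have "0 = solve (var_src i)"
    by (intro solve_unique) (auto simp: lin_rhs_def var_src_def split: gate.split)
  then show ?thesis
    by (simp add: col_Leaf)
qed

text \<open>Induction on the tree. Leaves with index at least \<open>n\<close> have the zero column,
  so finitely many generators suffice.\<close>

lemma col_in_span:
  assumes "\<And>i. i < n \<Longrightarrow> col (Leaf i) \<in> fv.span G"
    and "\<And>w w'. w \<in> G \<Longrightarrow> w' \<in> G \<Longrightarrow> bprod w w' \<in> fv.span G"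
  shows "col t \<in> fv.span G"
proof (induction t)
  case (Leaf i)
  then show ?case
    using assms(1)[of i] by (cases "i < n") (simp, simp only: col_Leaf_ge fv.span_zero not_less)
next
  case (Node t u)
  then show ?case
    using bprod_span[of G, OF assms(2)] by (simp add: col_Node bprod_def)
qed

section \<open>Echelon bases\<close>

text \<open>
  A basis is stored as a family of rows: row \<open>p\<close> belongs to the basis if its entry at \<open>p\<close> is
  nonzero. Rows that fail this are junk from \<open>col_span\<close>.
\<close>

definition pivots :: "(nat \<Rightarrow> nat \<Rightarrow> 'a) \<Rightarrow> nat set" where
  "pivots R = {p. p < size \<and> R p p \<noteq> 0}"

abbreviation basis :: "(nat \<Rightarrow> nat \<Rightarrow> 'a) \<Rightarrow> (nat \<Rightarrow> 'a) set" where
  "basis R \<equiv> R ` pivots R"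

text \<open>Junk rows are held to the same conditions. Hence products of arbitrary rows stay in
  \<open>col_span\<close>, and the final test may look at all rows without singling out
  pivots.\<close>

definition echelon :: "(nat \<Rightarrow> nat \<Rightarrow> 'a) \<Rightarrow> bool" where
  "echelon R \<longleftrightarrow> (\<forall>p < size. R p \<in> col_span \<and> (\<forall>q < p. R p q = 0))"

definition extends :: "(nat \<Rightarrow> nat \<Rightarrow> 'a) \<Rightarrow> (nat \<Rightarrow> nat \<Rightarrow> 'a) \<Rightarrow> bool" where
  "extends R R' \<longleftrightarrow> (\<forall>p \<in> pivots R. R' p = R p)"

lemma extends_refl [simp]: "extends R R"
  by (simp add: extends_def)

lemma extends_pivots: "extends R R' \<Longrightarrow> pivots R \<subseteq> pivots R'"
  by (auto simp: extends_def pivots_def)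

lemma extends_trans: "extends R R' \<Longrightarrow> extends R' R'' \<Longrightarrow> extends R R''"
  using extends_pivots[of R R'] by (auto simp: extends_def)

lemma extends_span:
  assumes "extends R R'" "v \<in> fv.span (basis R)"
  shows "v \<in> fv.span (basis R')"
proof -
  have "basis R \<subseteq> basis R'"
  proof (rule image_subsetI)
    fix p assume "p \<in> pivots R"
    then have "R p = R' p" "p \<in> pivots R'"
      using assms(1) extends_pivots[OF assms(1)] by (auto simp: extends_def)
    then show "R p \<in> basis R'"
      by (rule image_eqI)
  qed
  from fv.span_mono[OF this] assms(2) show ?thesis
    by (rule subsetD)
qed

lemma finite_pivots [simp]: "finite (pivots R)"
  by (rule finite_subset[of _ "{..<size}"]) (auto simp: pivots_def)

lemma card_pivots: "card (pivots R) \<le> size"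
  using card_mono[of "{..<size}" "pivots R"] by (auto simp: pivots_def)

definition complete :: "(nat \<Rightarrow> nat \<Rightarrow> 'a) \<Rightarrow> bool" where
  "complete R \<longleftrightarrow> (\<forall>t. col t \<in> fv.span (basis R))"

lemma complete_extends: "extends R R' \<Longrightarrow> complete R \<Longrightarrow> complete R'"
  unfolding complete_def by (blast intro: extends_span)

text \<open>A round of insertions that creates no new pivot has found a space closed under products.\<close>

lemma round_progress:
  assumes R: "extends R R'"
    and leaf: "\<And>i. i < n \<Longrightarrow> col (Leaf i) \<in> fv.span (basis R')"
    and node: "\<And>p q. p \<in> pivots R \<Longrightarrow> q \<in> pivots R \<Longrightarrow> bprod (R p) (R q) \<in> fv.span (basis R')"
    and prev: "complete R \<or> r \<le> card (pivots R)"
  shows "complete R' \<or> Suc r \<le> card (pivots R')"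
proof (cases "pivots R = pivots R'")
  case True
  \<comment> \<open>Products were formed from pivot rows of \<open>R\<close> only. Without a new
    pivot these rows are the whole basis of \<open>R'\<close>, so its span is closed under
    \<open>bprod\<close>.\<close>
  then have basis: "basis R' = basis R"
    using R True by (simp add: extends_def cong: image_cong)
  have "complete R'"
    unfolding complete_def
  proof (rule allI, rule col_in_span)
    fix w w' assume "w \<in> basis R'" "w' \<in> basis R'"
    then show "bprod w w' \<in> fv.span (basis R')"
      using node unfolding basis by blast
  qed (rule leaf)
  then show ?thesis ..
next
  case False
  then have "card (pivots R) < card (pivots R')"
    using extends_pivots[OF R] by (intro psubset_card_mono) auto
  then show ?thesis
    using prev complete_extends[OF R] by linarith
qed

text \<open>The invariant of Gaussian elimination: \<open>v\<close> is the residue of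
  \<open>v0\<close> after the positions below \<open>p\<close>. When the residue has become zero,
  the last clause places \<open>v0\<close> in the span.\<close>

definition inserting where
  "inserting R0 v0 p R v \<longleftrightarrow> echelon R \<and> extends R0 R \<and> v \<in> col_span \<and> (\<forall>q < p. v q = 0) \<and>
     v0 - v \<in> fv.span (basis R)"

text \<open>The residue lies in \<open>col_span\<close> and vanishes below \<open>p\<close>, so it
  may become row \<open>p\<close>, as pivot or as junk. Existing pivot rows are kept, which gives
  \<open>extends\<close>, and the vector subtracted is either zero or a multiple of a basis
  row.\<close>

lemma inserting_step:
  assumes inv: "inserting R0 v0 p R v" and p: "p < size"
    and R': "\<And>p'. p' < size \<Longrightarrow> p' \<noteq> p \<Longrightarrow> R' p' = R p'" "R' p = (if R p p = 0 then v else R p)"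
    and v': "v' = (\<lambda>q. v q - v p * inverse (R' p p) * R' p q)"
  shows "inserting R0 v0 (Suc p) R' v'"
proof -
  have "echelon R'"
    unfolding echelon_def
  proof (intro allI impI)
    fix p' assume "p' < size"
    then show "R' p' \<in> col_span \<and> (\<forall>q<p'. R' p' q = 0)"
      using inv R' by (cases "p' = p") (auto simp: inserting_def echelon_def)
  qed
  moreover have ext: "extends R R'"
    unfolding extends_def
  proof
    fix p' assume "p' \<in> pivots R"
    then show "R' p' = R p'"
      using R' by (cases "p' = p") (auto simp: pivots_def)
  qed
  moreover have v'_alt: "v' = v - (\<lambda>q. v p * inverse (R' p p) * R' p q)"
    by (simp add: v' fun_eq_iff)
  have "R' p \<in> col_span"
    using \<open>echelon R'\<close> p by (auto simp: echelon_def)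
  then have "v' \<in> col_span"
    unfolding v'_alt using inv by (auto simp: inserting_def intro!: fv.span_diff fv.span_scale)
  moreover have "v' q = 0" if "q < Suc p" for q
  proof (cases "q = p")
    case True
    \<comment> \<open>If \<open>R p p\<close> and \<open>v p\<close> both vanish, the scalar is zero
      and the entry is zero already. Otherwise \<open>R' p p\<close> is nonzero and the entry
      cancels.\<close>
    show ?thesis
      using R'(2) by (cases "R p p = 0"; cases "v p = 0") (simp_all add: v' True)
  next
    case False
    then show ?thesis
      using that inv \<open>echelon R'\<close> p by (simp add: v' inserting_def echelon_def)
  qed
  moreover have "v0 - v' \<in> fv.span (basis R')"
  proof -
    have "(\<lambda>q. v p * inverse (R' p p) * R' p q) \<in> fv.span (basis R')"
    proof (cases "R' p p = 0")
      case True
      then have "(\<lambda>q. v p * inverse (R' p p) * R' p q) = 0"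
        by (auto simp: fun_eq_iff)
      then show ?thesis
        by (simp only: fv.span_zero)
    next
      case False
      then show ?thesis
        using p by (intro fv.span_scale fv.span_base) (auto simp: pivots_def)
    qed
    moreover have "v0 - v \<in> fv.span (basis R')"
      using inv by (intro extends_span[OF ext]) (simp add: inserting_def)
    ultimately have "v0 - v + (\<lambda>q. v p * inverse (R' p p) * R' p q) \<in> fv.span (basis R')"
      by (intro fv.span_add)
    then show ?thesis
      by (simp add: v'_alt algebra_simps)
  qed
  ultimately show ?thesis
    using inv extends_trans[of R0 R R'] by (simp add: inserting_def)
qed

text \<open>The output entry is a linear functional, so it vanishes on a span once it vanishes on
  generators. If \<open>f\<close> is zero, this is applied to \<open>col_span\<close>, which
  contains all rows; conversely, completeness allows the basis as generators. The constant term
  belongs to no tree and is tested apart.\<close>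

lemma zero_iff:
  assumes f: "circuit_computes C f" and R: "echelon R" "complete R"
  shows "f = 0 \<longleftrightarrow> cst (output_node C) = 0 \<and> (\<forall>p < size. R p (output_node C) = 0)"
proof -
  let ?o = "output_node C"
  have o: "?o < size"
    using wf by (simp add: wf_circuit_def size_def)
  have f: "f = gate_poly ?o"
    using gate_poly_eqI[of ?o f] f by (simp only: circuit_computes_def)
  have vanish: "v ?o = 0" if "v \<in> fv.span G" "\<And>w. w \<in> G \<Longrightarrow> w ?o = 0" for v G
    by (rule fv.span_induct[OF that(1)]) (auto simp: fv.subspace_def that(2))
  show ?thesis
  proof
    assume "f = 0"
    then have *: "cst ?o = 0" "\<And>t. col t ?o = 0"
      using o by (simp_all add: cst_def col_def f)
    then have "w ?o = 0" if "w \<in> col_span" for w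
      using vanish[OF that] by blast
    then show "cst ?o = 0 \<and> (\<forall>p < size. R p ?o = 0)"
      using R(1) * by (simp add: echelon_def)
  next
    assume *: "cst ?o = 0 \<and> (\<forall>p < size. R p ?o = 0)"
    then have col: "col t ?o = 0" for t
      using R(2) by (intro vanish[of "col t" "basis R"]) (auto simp: complete_def pivots_def)
    show "f = 0"
    proof (rule poly_mapping_eqI)
      fix m show "Poly_Mapping.lookup f m = Poly_Mapping.lookup 0 m"
        using conjunct1[OF *] o col by (cases m) (simp_all add: cst_def col_def f)
    qed
  qed
qed

end

section \<open>The program\<close>

text \<open>
  Field arrays: \<open>1\<close> the constant coefficients of all gates, \<open>2\<close> the column being processed, \<open>3\<close> the
  rows of the basis, stored consecutively, \<open>4\<close> a scalar. Integer arrays: \<open>4\<close> the offsets of the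
  rows, \<open>5\<close> to \<open>11\<close> loop counters.
\<close>

abbreviation (input) nodes :: iexp where "nodes \<equiv> IGet 0 (INum 1)"
abbreviation (input) node :: iexp where "node \<equiv> ivar 9"
abbreviation (input) arg1 :: iexp where "arg1 \<equiv> IGet 2 node"
abbreviation (input) arg2 :: iexp where "arg2 \<equiv> IGet 3 node"

text \<open>Indices cannot be multiplied on this machine, so the start of a row is looked up in a
  table that is filled by repeated addition.\<close>

abbreviation (input) entry :: "nat \<Rightarrow> iexp \<Rightarrow> iexp" where
  "entry x e \<equiv> IAdd (IGet 4 (ivar x)) e"

text \<open>\<open>c\<close>, \<open>e\<close> and \<open>e'\<close> treat variables, constants and
  products. Sum gates need no parameter because all the recursions are additive there.\<close>

definition gate_update :: "nat \<Rightarrow> com \<Rightarrow> fexp \<Rightarrow> fexp \<Rightarrow> com" where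
  "gate_update d c e e' =
     If (Less (IGet 1 node) (INum 1)) c
       (If (Less (IGet 1 node) (INum 2)) (FSet d node e)
         (If (Less (IGet 1 node) (INum 3)) (FSet d node (FAdd (FGet d arg1) (FGet d arg2)))
           (FSet d node e')))"

definition cst_update :: com where
  "cst_update = gate_update 1 (FSet 1 node FZero) (FGet 0 node) (FMul (FGet 1 arg1) (FGet 1 arg2))"

definition unit_products :: fexp where
  "unit_products = FAdd (FMul (FGet 1 arg1) (FGet 2 arg2)) (FMul (FGet 1 arg2) (FGet 2 arg1))"

definition var_update :: com where
  "var_update = gate_update 2
     (If (And (Not (Less arg1 (ivar 6))) (Not (Less (ivar 6) arg1)))
       (FSet 2 node FOne) (FSet 2 node FZero))
     FZero unit_products"

definition node_update :: com where
  "node_update = gate_update 2 (FSet 2 node FZero) FZero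
     (FAdd unit_products (FMul (FGet 3 (entry 6 arg1)) (FGet 3 (entry 7 arg2))))"

text \<open>
  The list of gates need not be sorted. A sweep settles every gate whose inputs were settled by
  the previous sweep, so as many sweeps as there are nodes suffice.
\<close>

definition sweeps :: "com \<Rightarrow> com" where
  "sweeps c = For 8 nodes (For 9 nodes c)"

definition copy_row :: com where
  "copy_row = For 11 nodes (FSet 3 (entry 10 (ivar 11)) (FGet 2 (ivar 11)))"

text \<open>The scalar has a cell of its own because the vector entry it is computed from is
  overwritten during the loop.\<close>

definition reduce_by_row :: com where
  "reduce_by_row = For 11 nodes (FSet 2 (ivar 11)
     (FSub (FGet 2 (ivar 11)) (FMul (FGet 4 (INum 0)) (FGet 3 (entry 10 (ivar 11))))))"

text \<open>
  If neither the vector nor row \<open>p\<close> has an entry at \<open>p\<close>, then the row is overwritten by junk and the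
  scalar is \<open>0 * inverse 0 = 0\<close>, so no case distinction is needed.
\<close>

definition insert_vec :: com where
  "insert_vec = For 10 nodes
     (Seq (If (IsZero (FGet 3 (entry 10 (ivar 10)))) copy_row Skip)
     (Seq (FSet 4 (INum 0) (FMul (FGet 2 (ivar 10)) (FInv (FGet 3 (entry 10 (ivar 10))))))
       reduce_by_row))"

definition one_round :: com where
  "one_round = Seq
     (For 6 (ivar 0) (Seq (sweeps var_update) insert_vec))
     (For 6 nodes (For 7 nodes (Seq (sweeps node_update) insert_vec)))"

text \<open>The answer overwrites the number of variables, which is not read any more at this
  stage.\<close>

definition decide :: com where
  "decide = Seq (ISet 0 (INum 0) (INum 1))
     (Seq (If (IsZero (FGet 1 (IGet 0 (INum 2)))) Skip (ISet 0 (INum 0) (INum 0)))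
       (For 6 nodes (If (IsZero (FGet 3 (entry 6 (IGet 0 (INum 2))))) Skip
         (ISet 0 (INum 0) (INum 0)))))"

definition row_offsets :: com where
  "row_offsets = For 6 nodes (ISet 4 (IAdd (ivar 6) (INum 1)) (IAdd (IGet 4 (ivar 6)) nodes))"

text \<open>Each round reaches completeness or gains a pivot. As there are at most as many pivots as
  nodes, one round more than nodes is enough.\<close>

definition zero_test :: com where
  "zero_test = Seq row_offsets (Seq (sweeps cst_update)
     (Seq (For 5 (IAdd nodes (INum 1)) one_round) decide))"

section \<open>Correctness and running time\<close>

context circuit
begin

text \<open>A common bound for the lengths of all loops, which makes the total cost a function of
  one number.\<close>

definition M :: nat where "M = size + n + 1"

lemma M_bounds [simp]: "size \<le> M" "n \<le> M" "Suc size \<le> M"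
  by (simp_all add: M_def)

section \<open>Invariants of the memory\<close>

definition input :: "'a state \<Rightarrow> bool" where
  "input s \<longleftrightarrow> imem s 0 0 = n \<and> imem s 0 (Suc 0) = size \<and> imem s 0 2 = output_node C \<and>
     (\<forall>g < size. imem s 1 g = gate_kind (gates C ! g) \<and> imem s 2 g = gate_arg1 (gates C ! g) \<and>
       imem s 3 g = gate_arg2 (gates C ! g) \<and> fmem s 0 g = gate_const (gates C ! g))"

definition env :: "'a state \<Rightarrow> bool" where
  "env s \<longleftrightarrow> input s \<and> (\<forall>p < size. imem s 4 p = p * size) \<and> (\<forall>g < size. fmem s 1 g = cst g)"

text \<open>The cut at \<open>size\<close> is essential: in memory, row \<open>p\<close> is followed
  directly by row \<open>p + 1\<close>.\<close>

definition row :: "'a state \<Rightarrow> nat \<Rightarrow> nat \<Rightarrow> 'a" where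
  "row s p q = (if q < size then fmem s 3 (p * size + q) else 0)"

definition vec :: "'a state \<Rightarrow> nat \<Rightarrow> 'a" where
  "vec s q = (if q < size then fmem s 2 q else 0)"

lemma row_cong: "fmem s 3 = fmem s' 3 \<Longrightarrow> row s = row s'"
  by (simp add: row_def fun_eq_iff)

lemma vec_cong: "fmem s 2 = fmem s' 2 \<Longrightarrow> vec s = vec s'"
  by (simp add: vec_def fun_eq_iff)

lemma row_update [simp]: "row (iupdate a i k s) = row s" "b \<noteq> 3 \<Longrightarrow> row (fupdate b i x s) = row s"
  by (simp_all add: row_def fun_eq_iff)

lemma vec_update [simp]: "vec (iupdate a i k s) = vec s" "b \<noteq> 2 \<Longrightarrow> vec (fupdate b i x s) = vec s"
  by (simp_all add: vec_def fun_eq_iff)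

lemma input_same:
  "same_except A B s s' \<Longrightarrow> A \<inter> {0, 1, 2, 3} = {} \<Longrightarrow> 0 \<notin> B \<Longrightarrow> input s \<Longrightarrow> input s'"
  by (auto simp: same_except_def input_def)

lemma env_same:
  "same_except A B s s' \<Longrightarrow> A \<inter> {0, 1, 2, 3, 4} = {} \<Longrightarrow> B \<inter> {0, 1} = {} \<Longrightarrow> env s \<Longrightarrow> env s'"
  using input_same[of A B s s'] by (auto simp: same_except_def env_def)

text \<open>Uniqueness of quotient and remainder: different entries of the matrix occupy different
  cells.\<close>

lemma entry_eq:
  "q < size \<Longrightarrow> q' < size \<Longrightarrow> p * size + q = p' * size + q' \<longleftrightarrow> p = p' \<and> q = q'"
proof
  assume q: "q < size" "q' < size" and eq: "p * size + q = p' * size + q'"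
  from arg_cong[OF eq, of "\<lambda>k. k div size"] arg_cong[OF eq, of "\<lambda>k. k mod size"] q
  show "p = p' \<and> q = q'" by simp
qed simp

section \<open>Updates of a single gate\<close>

lemma reach_gate_update:
  assumes inp: "input s" and g: "g < size" "imem s 9 0 = g"
    and var: "\<And>i. gates C ! g = Var i \<Longrightarrow> reach c s 60 Q"
    and const: "\<And>k. gates C ! g = Const k \<Longrightarrow> Q (fupdate d g (fval e s) s)"
    and plus: "\<And>l r. gates C ! g = Plus l r \<Longrightarrow> Q (fupdate d g (fmem s d l + fmem s d r) s)"
    and times: "\<And>l r. gates C ! g = Times l r \<Longrightarrow> Q (fupdate d g (fval e' s) s)"
    and cost: "fcost e \<le> 60" "fcost e' \<le> 60"
  shows "reach (gate_update d c e e') s 150 Q"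
proof -
  have i: "imem s 1 g = gate_kind (gates C ! g)" "imem s 2 g = gate_arg1 (gates C ! g)"
    "imem s 3 g = gate_arg2 (gates C ! g)"
    using inp g by (auto simp: input_def)
  \<comment> \<open>150 covers up to three tests of the gate kind and one update, whose command or
    expression costs at most 60.\<close>
  show ?thesis
  proof (cases "gates C ! g")
    case (Var j)
    have "reach c s (150 - (bcost (Less (IGet 1 node) (INum 1)) + 1)) Q"
      using var[OF Var] by (rule reach_mono) simp_all
    then show ?thesis
      unfolding gate_update_def using i(1) g(2) Var by (intro reach_If) simp_all
  next
    case (Const k)
    then show ?thesis
      unfolding gate_update_def using i(1) g(2) cost const[OF Const]
      by (intro reach_If reach_FSet) simp_all
  next
    case (Plus l r)
    then show ?thesis
      unfolding gate_update_def using i g(2) cost plus[OF Plus]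
      by (intro reach_If reach_FSet) simp_all
  next
    case (Times l r)
    then show ?thesis
      unfolding gate_update_def using i g(2) cost times[OF Times]
      by (intro reach_If reach_FSet) simp_all
  qed
qed

lemma reach_cst_update:
  assumes "input s" "g < size" "imem s 9 0 = g"
  shows "reach cst_update s 150 (\<lambda>s'. s' = fupdate 1 g (cst_rhs g (fmem s 1)) s)"
proof -
  have "imem s 2 g = gate_arg1 (gates C ! g)" "imem s 3 g = gate_arg2 (gates C ! g)"
    "fmem s 0 g = gate_const (gates C ! g)"
    using assms by (auto simp: input_def)
  then show ?thesis
    unfolding cst_update_def
    using assms by (intro reach_gate_update reach_FSet) (auto simp: cst_rhs_def)
qed

lemma fval_unit_products:
  assumes "env s" "g < size" "imem s 9 0 = g" "gates C ! g = Times l r"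
  shows "fval unit_products s = cst l * fmem s 2 r + cst r * fmem s 2 l"
  using assms inputs_bound(2)[OF assms(2,4)] by (simp add: unit_products_def env_def input_def)

lemma fcost_unit_products: "fcost unit_products = 19"
  by (simp add: unit_products_def)

lemma reach_var_update:
  assumes "env s" "g < size" "imem s 9 0 = g" "imem s 6 0 = i"
  shows "reach var_update s 150 (\<lambda>s'. s' = fupdate 2 g (lin_rhs (var_src i) g (fmem s 2)) s)"
  unfolding var_update_def
proof (rule reach_gate_update[where g = g])
  fix j assume "gates C ! g = Var j"
  moreover from this have "imem s 2 g = j"
    using assms by (simp add: env_def input_def)
  ultimately show "reach (If (And (Not (Less arg1 (ivar 6))) (Not (Less (ivar 6) arg1)))
      (FSet 2 node FOne) (FSet 2 node FZero)) s 60
      (\<lambda>s'. s' = fupdate 2 g (lin_rhs (var_src i) g (fmem s 2)) s)"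
    using assms by (intro reach_If reach_FSet) (auto simp: lin_rhs_def var_src_def)
qed (use assms in \<open>simp_all add: env_def lin_rhs_def var_src_def fcost_unit_products
      fval_unit_products[OF assms(1-3)]\<close>)

lemma reach_node_update:
  assumes "env s" "g < size" "imem s 9 0 = g" "imem s 6 0 = p" "imem s 7 0 = q" "p < size" "q < size"
  shows "reach node_update s 150
    (\<lambda>s'. s' = fupdate 2 g (lin_rhs (node_src (row s p) (row s q)) g (fmem s 2)) s)"
  unfolding node_update_def
proof (rule reach_gate_update[where g = g])
  fix j assume "gates C ! g = Var j"
  then show "reach (FSet 2 node FZero) s 60
      (\<lambda>s'. s' = fupdate 2 g (lin_rhs (node_src (row s p) (row s q)) g (fmem s 2)) s)"
    using assms by (intro reach_FSet) (auto simp: lin_rhs_def node_src_def)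
next
  fix l r assume g: "gates C ! g = Times l r"
  then have "l < size" "r < size" "imem s 2 g = l" "imem s 3 g = r" "imem s 4 p = p * size"
      "imem s 4 q = q * size"
    using assms inputs_bound(2)[OF assms(2) g] by (simp_all add: env_def input_def)
  then show "fupdate 2 g (fval (FAdd unit_products
        (FMul (FGet 3 (entry 6 arg1)) (FGet 3 (entry 7 arg2)))) s) s =
      fupdate 2 g (lin_rhs (node_src (row s p) (row s q)) g (fmem s 2)) s"
    using assms g by (simp add: lin_rhs_def node_src_def row_def fval_unit_products[OF assms(1-3)])
qed (use assms in \<open>simp_all add: env_def lin_rhs_def node_src_def fcost_unit_products\<close>)

text \<open>After \<open>k\<close> sweeps all gates of level below \<open>k\<close> are correct;
  within a sweep this also holds for the gates of level \<open>k\<close> already visited. Levels are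
  below \<open>size\<close>, so \<open>size\<close> sweeps settle everything, from arbitrary initial
  values.\<close>

lemma reach_sweeps:
  assumes loc: "local_rhs rhs" and sol: "\<And>g. g < size \<Longrightarrow> sol g = rhs g sol"
    and nodes: "imem s 0 (Suc 0) = size"
    and upd: "\<And>s' g. same_except {8, 9} {d} s s' \<Longrightarrow> g < size \<Longrightarrow> imem s' 9 0 = g \<Longrightarrow>
      reach c s' T (\<lambda>s''. s'' = fupdate d g (rhs g (fmem s' d)) s')"
  shows "reach (sweeps c) s (loop_cost M (loop_cost M T))
    (\<lambda>s'. same_except {8, 9} {d} s s' \<and> (\<forall>g < size. fmem s' d g = sol g))"
  unfolding sweeps_def
proof (rule reach_For[where N = size and
      I = "\<lambda>k s'. same_except {8, 9} {d} s s' \<and> (\<forall>g < size. lev g < k \<longrightarrow> fmem s' d g = sol g)"])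
  fix k s1
  assume 1: "same_except {8, 9} {d} s s1 \<and> (\<forall>g < size. lev g < k \<longrightarrow> fmem s1 d g = sol g)"
    and k: "imem s1 8 0 = k"
  show "reach (For 9 nodes c) s1 (loop_cost M T)
     (\<lambda>s'. imem s' 8 0 = k \<and> same_except {8, 9} {d} s (iupdate 8 0 (Suc k) s') \<and>
       (\<forall>g < size. lev g < Suc k \<longrightarrow> fmem (iupdate 8 0 (Suc k) s') d g = sol g))"
  proof (rule reach_For[where N = size and
        I = "\<lambda>j s'. imem s' 8 0 = k \<and> same_except {8, 9} {d} s s' \<and>
          (\<forall>g < size. lev g < k \<or> lev g < Suc k \<and> g < j \<longrightarrow> fmem s' d g = sol g)"])
    fix j s2
    assume j: "j < size" "imem s2 9 0 = j"
      and 2: "imem s2 8 0 = k \<and> same_except {8, 9} {d} s s2 \<and>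
          (\<forall>g < size. lev g < k \<or> lev g < Suc k \<and> g < j \<longrightarrow> fmem s2 d g = sol g)"
    \<comment> \<open>The inputs of \<open>j\<close> have level below \<open>k\<close>. This
      includes gates settled earlier: recomputing a correct value leaves it correct.\<close>
    have new: "rhs j (fmem s2 d) = sol j" if "lev j < Suc k"
    proof -
      have "rhs j (fmem s2 d) = rhs j sol"
      proof (rule local_rhsD[OF loc j(1)])
        fix h assume "(h, j) \<in> E"
        then show "fmem s2 d h = sol h"
          using 2 lev_less[of h j] E_bound[of h j] that by auto
      qed
      then show ?thesis
        using sol[OF j(1)] by simp
    qed
    show "reach c s2 T (\<lambda>s'. imem s' 9 0 = j \<and> imem (iupdate 9 0 (Suc j) s') 8 0 = k \<and>
        same_except {8, 9} {d} s (iupdate 9 0 (Suc j) s') \<and>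
        (\<forall>g < size. lev g < k \<or> lev g < Suc k \<and> g < Suc j \<longrightarrow>
          fmem (iupdate 9 0 (Suc j) s') d g = sol g))"
    proof (rule reach_mono[OF upd])
      show "same_except {8, 9} {d} s s2" "j < size" "imem s2 9 0 = j"
        using j 2 by auto
      fix s' assume s': "s' = fupdate d j (rhs j (fmem s2 d)) s2"
      then show "imem s' 9 0 = j \<and> imem (iupdate 9 0 (Suc j) s') 8 0 = k \<and>
        same_except {8, 9} {d} s (iupdate 9 0 (Suc j) s') \<and>
        (\<forall>g < size. lev g < k \<or> lev g < Suc k \<and> g < Suc j \<longrightarrow>
          fmem (iupdate 9 0 (Suc j) s') d g = sol g)"
        using j 2 new by (auto intro!: same_except_iupdate same_except_fupdate simp: less_Suc_eq)
    qed simp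
  qed (use 1 k nodes in \<open>auto simp: same_except_def\<close>)
qed (use nodes lev_bound in \<open>auto simp: same_except_def\<close>)

section \<open>Insertion of a vector into the basis\<close>

lemma reach_copy_row:
  assumes env: "env s" and p: "imem s 10 0 = p" "p < size"
  shows "reach copy_row s (loop_cost M 40) (\<lambda>s'. same_except {11} {3} s s' \<and>
    (\<forall>p' < size. row s' p' = (if p' = p then vec s else row s p')))"
  \<comment> \<open>All rows share one array, so the frame condition cannot protect the other rows;
    the invariant has to speak of every entry.\<close>
  unfolding copy_row_def
proof (rule reach_For[where N = size and
      I = "\<lambda>k s'. same_except {11} {3} s s' \<and>
        (\<forall>p' < size. \<forall>q < size. fmem s' 3 (p' * size + q) =
          (if p' = p \<and> q < k then fmem s 2 q else fmem s 3 (p' * size + q)))"])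
  fix k s1
  assume k: "k < size" "imem s1 11 0 = k"
    and 1: "same_except {11} {3} s s1 \<and>
        (\<forall>p' < size. \<forall>q < size. fmem s1 3 (p' * size + q) =
          (if p' = p \<and> q < k then fmem s 2 q else fmem s 3 (p' * size + q)))"
  have "env s1" "imem s1 10 0 = p" "fmem s1 2 = fmem s 2"
    using env_same[of "{11}" "{3}" s s1] 1 env p by (auto simp: same_except_def)
  then show "reach (FSet 3 (entry 10 (ivar 11)) (FGet 2 (ivar 11))) s1 40
    (\<lambda>s'. imem s' 11 0 = k \<and> same_except {11} {3} s (iupdate 11 0 (Suc k) s') \<and>
        (\<forall>p' < size. \<forall>q < size. fmem (iupdate 11 0 (Suc k) s') 3 (p' * size + q) =
          (if p' = p \<and> q < Suc k then fmem s 2 q else fmem s 3 (p' * size + q))))"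
    using k 1 p
    by (intro reach_FSet)
       (auto simp: env_def entry_eq less_Suc_eq intro!: same_except_iupdate same_except_fupdate)
qed (use env in \<open>auto simp: env_def input_def same_except_def row_def vec_def fun_eq_iff\<close>)

lemma reach_reduce_by_row:
  assumes env: "env s" and p: "imem s 10 0 = p" "p < size" and x: "fmem s 4 0 = x"
  shows "reach reduce_by_row s (loop_cost M 40) (\<lambda>s'. same_except {11} {2} s s' \<and>
    vec s' = (\<lambda>q. vec s q - x * row s p q))"
  unfolding reduce_by_row_def
proof (rule reach_For[where N = size and
      I = "\<lambda>k s'. same_except {11} {2} s s' \<and> (\<forall>q < size. fmem s' 2 q =
          (if q < k then fmem s 2 q - x * row s p q else fmem s 2 q))"])
  fix k s1
  assume k: "k < size" "imem s1 11 0 = k"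
    and 1: "same_except {11} {2} s s1 \<and> (\<forall>q < size. fmem s1 2 q =
          (if q < k then fmem s 2 q - x * row s p q else fmem s 2 q))"
  have "env s1" "imem s1 10 0 = p" "fmem s1 3 = fmem s 3" "fmem s1 4 = fmem s 4"
    using env_same[of "{11}" "{2}" s s1] 1 env p by (auto simp: same_except_def)
  then show "reach (FSet 2 (ivar 11)
     (FSub (FGet 2 (ivar 11)) (FMul (FGet 4 (INum 0)) (FGet 3 (entry 10 (ivar 11)))))) s1 40
    (\<lambda>s'. imem s' 11 0 = k \<and> same_except {11} {2} s (iupdate 11 0 (Suc k) s') \<and>
        (\<forall>q < size. fmem (iupdate 11 0 (Suc k) s') 2 q =
          (if q < Suc k then fmem s 2 q - x * row s p q else fmem s 2 q)))"
    using k 1 p x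
    by (intro reach_FSet)
       (auto simp: env_def row_def less_Suc_eq intro!: same_except_iupdate same_except_fupdate)
qed (use env in \<open>auto simp: env_def input_def same_except_def row_def vec_def fun_eq_iff\<close>)

definition insert_cost :: nat where
  "insert_cost = loop_cost M (2 * loop_cost M 40 + 50)"

lemma reach_insert_vec:
  assumes env: "env s" and ech: "echelon (row s)" and vec: "vec s \<in> col_span"
  shows "reach insert_vec s insert_cost (\<lambda>s'. same_except {10, 11} {2, 3, 4} s s' \<and>
    echelon (row s') \<and> extends (row s) (row s') \<and> vec s \<in> fv.span (basis (row s')))"
  unfolding insert_vec_def insert_cost_def
proof (rule reach_For[where N = size and
      I = "\<lambda>p s'. same_except {10, 11} {2, 3, 4} s s' \<and>
        inserting (row s) (vec s) p (row s') (vec s')"])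
  fix p s1
  assume p: "p < size" "imem s1 10 0 = p"
    and 1: "same_except {10, 11} {2, 3, 4} s s1 \<and>
      inserting (row s) (vec s) p (row s1) (vec s1)"
  have env1: "env s1"
    using env_same[of "{10, 11}" "{2, 3, 4}" s s1] 1 env by auto
  have diag: "fval (FGet 3 (entry 10 (ivar 10))) s' = row s' p p"
    if "env s'" "imem s' 10 0 = p" for s' :: "'a state"
    using that p by (simp add: env_def row_def)
  \<comment> \<open>The form in which \<open>inserting_step\<close> expects its new rows.\<close>
  let ?copied = "\<lambda>s2. same_except {11} {3} s1 s2 \<and>
    (\<forall>p' < size. p' \<noteq> p \<longrightarrow> row s2 p' = row s1 p') \<and>
    row s2 p = (if row s1 p p = 0 then vec s1 else row s1 p)"
  let ?after = "\<lambda>s'. imem s' 10 0 = p \<and> same_except {10, 11} {2, 3, 4} s (iupdate 10 0 (Suc p) s') \<and>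
    inserting (row s) (vec s) (Suc p) (row (iupdate 10 0 (Suc p) s')) (vec (iupdate 10 0 (Suc p) s'))"
  let ?scalar = "FSet 4 (INum 0) (FMul (FGet 2 (ivar 10)) (FInv (FGet 3 (entry 10 (ivar 10)))))"
  have copied: "reach (If (IsZero (FGet 3 (entry 10 (ivar 10)))) copy_row Skip) s1
      (loop_cost M 40 + 20) ?copied"
  proof (rule reach_If)
    assume "bval (IsZero (FGet 3 (entry 10 (ivar 10)))) s1"
    then have "row s1 p p = 0"
      using diag[OF env1 p(2)] by simp
    then show "reach copy_row s1
        (loop_cost M 40 + 20 - (bcost (IsZero (FGet 3 (entry 10 (ivar 10)))) + 1)) ?copied"
      by (intro reach_mono[OF reach_copy_row[OF env1 p(2,1)]]) (use p(1) in auto)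
  next
    assume "\<not> bval (IsZero (FGet 3 (entry 10 (ivar 10)))) s1"
    then have "row s1 p p \<noteq> 0"
      using diag[OF env1 p(2)] by simp
    then show "reach Skip s1
        (loop_cost M 40 + 20 - (bcost (IsZero (FGet 3 (entry 10 (ivar 10)))) + 1)) ?copied"
      by (intro reach_Skip) auto
  qed simp
  have rest: "reach (Seq ?scalar reduce_by_row) s2 (20 + loop_cost M 40) ?after" if 2: "?copied s2" for s2
  proof (rule reach_Seq[where ?T1.0 = 20, OF reach_FSet])
    have env2: "env s2" and p2: "imem s2 10 0 = p" and vec2: "vec s2 = vec s1"
      using env_same[of "{11}" "{3}" s1 s2] 2 env1 p vec_cong[of s2 s1] by (auto simp: same_except_def)
    let ?x = "vec s1 p * inverse (row s2 p p)"
    let ?s3 = "fupdate 4 0 ?x s2"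
    have "fval (FMul (FGet 2 (ivar 10)) (FInv (FGet 3 (entry 10 (ivar 10))))) s2 = ?x"
      using diag[OF env2 p2] p p2 vec2[symmetric] by (simp add: vec_def)
    then have s3: "fupdate 4 (ival (INum 0) s2)
        (fval (FMul (FGet 2 (ivar 10)) (FInv (FGet 3 (entry 10 (ivar 10))))) s2) s2 = ?s3"
      by simp
    have env3: "env ?s3"
      by (rule env_same[of "{}" "{4}" s2]) (auto simp: env2 intro: same_except_fupdate)
    have red: "reach reduce_by_row ?s3 (loop_cost M 40) (\<lambda>s'. same_except {11} {2} ?s3 s' \<and>
        vec s' = (\<lambda>q. vec ?s3 q - ?x * row ?s3 p q))"
      by (rule reach_reduce_by_row) (use env3 p p2 in auto)
    show "reach reduce_by_row (fupdate 4 (ival (INum 0) s2)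
        (fval (FMul (FGet 2 (ivar 10)) (FInv (FGet 3 (entry 10 (ivar 10))))) s2) s2)
        (loop_cost M 40) ?after"
      unfolding s3
    proof (rule reach_mono[OF red])
      fix s4
      assume 4: "same_except {11} {2} ?s3 s4 \<and> vec s4 = (\<lambda>q. vec ?s3 q - ?x * row ?s3 p q)"
      have row4: "row s4 = row s2"
        using 4 row_cong[of s4 s2] by (auto simp: same_except_def)
      have "inserting (row s) (vec s) (Suc p) (row s4) (vec s4)"
        using 1 p(1)
      proof (rule inserting_step[OF conjunct2])
        show "vec s4 = (\<lambda>q. vec s1 q - vec s1 p * inverse (row s4 p p) * row s4 p q)"
          using 4 vec2 by (simp add: row4)
      qed (use 2 row4 in auto)
      moreover have "same_except {10, 11} {2, 3, 4} s s4"
      proof -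
        have "same_except {10, 11} {2, 3, 4} s s2"
          by (rule same_except_trans[OF conjunct1[OF 1] conjunct1[OF 2]]) auto
        then have "same_except {10, 11} {2, 3, 4} s ?s3"
          by (rule same_except_fupdate) simp
        then show ?thesis
          by (rule same_except_trans[OF _ conjunct1[OF 4]]) auto
      qed
      moreover have "imem s4 10 0 = p"
        using 4 p2 by (simp add: same_except_def)
      ultimately show "?after s4"
        by (simp add: same_except_iupdate)
    qed simp
  qed simp_all
  show "reach (Seq (If (IsZero (FGet 3 (entry 10 (ivar 10)))) copy_row Skip)
     (Seq ?scalar reduce_by_row)) s1 (2 * loop_cost M 40 + 50) ?after"
    by (rule reach_Seq[OF reach_mono[OF copied order_refl rest]]) simp_all
next
  fix s'
  assume *: "same_except {10, 11} {2, 3, 4} s s' \<and> inserting (row s) (vec s) size (row s') (vec s')"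
  \<comment> \<open>Below \<open>size\<close> the invariant gives zero, beyond it the definition of
    \<open>vec\<close> does. So the residue is gone.\<close>
  then have "vec s' = 0"
    by (auto simp: inserting_def fun_eq_iff vec_def)
  with * show "same_except {10, 11} {2, 3, 4} s s' \<and> echelon (row s') \<and>
      extends (row s) (row s') \<and> vec s \<in> fv.span (basis (row s'))"
    by (simp add: inserting_def)
next
  show "same_except {10, 11} {2, 3, 4} s (iupdate 10 0 0 s) \<and>
    inserting (row s) (vec s) 0 (row (iupdate 10 0 0 s)) (vec (iupdate 10 0 0 s))"
    using ech vec by (simp add: same_except_iupdate inserting_def fv.span_zero)
qed (use env in \<open>auto simp: env_def input_def same_except_def\<close>)

section \<open>Computing and inserting one column\<close>

definition column_cost :: nat where
  "column_cost = loop_cost M (loop_cost M 150) + insert_cost"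

lemma reach_column:
  assumes env: "env s" and ech: "echelon (row s)" and a: "solve a \<in> col_span"
    and upd: "\<And>s' g. same_except {8, 9} {2} s s' \<Longrightarrow> g < size \<Longrightarrow> imem s' 9 0 = g \<Longrightarrow>
      reach c s' 150 (\<lambda>s''. s'' = fupdate 2 g (lin_rhs a g (fmem s' 2)) s')"
  shows "reach (Seq (sweeps c) insert_vec) s column_cost
    (\<lambda>s'. same_except {8, 9, 10, 11} {2, 3, 4} s s' \<and> echelon (row s') \<and> extends (row s) (row s') \<and>
      solve a \<in> fv.span (basis (row s')))"
proof (rule reach_Seq[OF reach_mono[OF reach_sweeps[OF local_lin_rhs _ _ upd] order_refl]])
  show "solve a g = lin_rhs a g (solve a)" if "g < size" for g
    using that solve_eq[of a g] by simp
  show "imem s 0 (Suc 0) = size"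
    using env by (simp add: env_def input_def)
  fix s1
  assume 1: "same_except {8, 9} {2} s s1 \<and> (\<forall>g < size. fmem s1 2 g = solve a g)"
  then have v: "vec s1 = solve a"
    using solve_eq[of a] by (auto simp: vec_def fun_eq_iff)
  have r: "row s1 = row s"
    using 1 by (intro row_cong) (simp add: same_except_def)
  have "env s1"
    using 1 env env_same[of "{8, 9}" "{2}" s s1] by simp
  then have "reach insert_vec s1 insert_cost (\<lambda>s'. same_except {10, 11} {2, 3, 4} s1 s' \<and>
    echelon (row s') \<and> extends (row s1) (row s') \<and> vec s1 \<in> fv.span (basis (row s')))"
    using ech a v r by (intro reach_insert_vec) simp_all
  then show "reach insert_vec s1 insert_cost
    (\<lambda>s'. same_except {8, 9, 10, 11} {2, 3, 4} s s' \<and> echelon (row s') \<and> extends (row s) (row s') \<and>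
      solve a \<in> fv.span (basis (row s')))"
    by (rule reach_mono) (use 1 r v in \<open>auto intro: same_except_trans[OF conjunct1[OF 1]]\<close>)
qed (auto simp: column_cost_def)

text \<open>The progress made during a round. Counter 5, which counts the rounds, is not among the
  arrays that may change.\<close>

definition grown :: "'a state \<Rightarrow> 'a state \<Rightarrow> bool" where
  "grown s s' \<longleftrightarrow> same_except {6, 7, 8, 9, 10, 11} {2, 3, 4} s s' \<and> echelon (row s') \<and>
     extends (row s) (row s')"

lemma grown_trans: "grown s s' \<Longrightarrow> grown s' s'' \<Longrightarrow> grown s s''"
  unfolding grown_def using extends_trans by (auto intro: same_except_trans)

lemma grown_iupdate: "grown s s' \<Longrightarrow> a \<in> {6, 7} \<Longrightarrow> grown s (iupdate a i k s')"
  unfolding grown_def by (auto intro: same_except_iupdate)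

lemma grown_env: "grown s s' \<Longrightarrow> env s \<Longrightarrow> env s'"
  unfolding grown_def using env_same[of "{6, 7, 8, 9, 10, 11}" "{2, 3, 4}" s s'] by simp

lemma grown_span: "grown s s' \<Longrightarrow> v \<in> fv.span (basis (row s)) \<Longrightarrow> v \<in> fv.span (basis (row s'))"
  unfolding grown_def by (blast intro: extends_span)

lemma grown_of_column:
  assumes "same_except {8, 9, 10, 11} {2, 3, 4} s s' \<and> echelon (row s') \<and> extends (row s) (row s') \<and>
    v \<in> fv.span (basis (row s'))"
  shows "grown s s' \<and> imem s' 6 = imem s 6 \<and> imem s' 7 = imem s 7 \<and> v \<in> fv.span (basis (row s'))"
  using assms by (simp add: grown_def same_except_def)

lemma reach_var_column:
  assumes env: "env s" and ech: "echelon (row s)" and i: "imem s 6 0 = i"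
  shows "reach (Seq (sweeps var_update) insert_vec) s column_cost
    (\<lambda>s'. grown s s' \<and> imem s' 6 = imem s 6 \<and> imem s' 7 = imem s 7 \<and>
      col (Leaf i) \<in> fv.span (basis (row s')))"
  unfolding col_Leaf
proof (rule reach_mono[OF reach_column[OF env ech] order_refl grown_of_column])
  show "solve (var_src i) \<in> col_span"
    by (auto simp flip: col_Leaf intro: fv.span_base)
  fix s' :: "'a state" and g assume "same_except {8, 9} {2} s s'" "g < size" "imem s' 9 0 = g"
  then show "reach var_update s' 150 (\<lambda>s''. s'' = fupdate 2 g (lin_rhs (var_src i) g (fmem s' 2)) s')"
    using env_same[of "{8, 9}" "{2}" s s'] env i
    by (intro reach_var_update) (auto simp: same_except_def)
qed

text \<open>The rows \<open>p\<close> and \<open>q\<close> need not be pivots: junk rows lie in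
  \<open>col_span\<close> as well, so their product may safely be inserted.\<close>

lemma reach_node_column:
  assumes env: "env s" and ech: "echelon (row s)"
    and pq: "imem s 6 0 = p" "p < size" "imem s 7 0 = q" "q < size"
  shows "reach (Seq (sweeps node_update) insert_vec) s column_cost
    (\<lambda>s'. grown s s' \<and> imem s' 6 = imem s 6 \<and> imem s' 7 = imem s 7 \<and>
      bprod (row s p) (row s q) \<in> fv.span (basis (row s')))"
  unfolding bprod_def
proof (rule reach_mono[OF reach_column[OF env ech] order_refl grown_of_column])
  show "solve (node_src (row s p) (row s q)) \<in> col_span"
    using ech pq by (auto simp flip: bprod_def simp: echelon_def intro: bprod_col_span)
  fix s' :: "'a state" and g assume s': "same_except {8, 9} {2} s s'" "g < size" "imem s' 9 0 = g"
  \<comment> \<open>The sweeps write to field array 2 only, so both factors stay fixed while the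
    system is solved.\<close>
  have "row s' = row s"
    using s' by (intro row_cong) (simp add: same_except_def)
  moreover have "env s'" "imem s' 6 0 = p" "imem s' 7 0 = q"
    using env_same[of "{8, 9}" "{2}" s s'] env s' pq by (auto simp: same_except_def)
  ultimately show "reach node_update s' 150
      (\<lambda>s''. s'' = fupdate 2 g (lin_rhs (node_src (row s p) (row s q)) g (fmem s' 2)) s')"
    using reach_node_update[of s' g p q] s' pq by simp
qed

section \<open>Rounds of insertions\<close>

definition round_cost :: nat where
  "round_cost = loop_cost M column_cost + loop_cost M (loop_cost M column_cost)"

lemma reach_leaf_loop:
  assumes env: "env s" and ech: "echelon (row s)"
  shows "reach (For 6 (ivar 0) (Seq (sweeps var_update) insert_vec)) s (loop_cost M column_cost)
    (\<lambda>s'. grown s s' \<and> (\<forall>i < n. col (Leaf i) \<in> fv.span (basis (row s'))))"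
proof (rule reach_For[where N = n and
      I = "\<lambda>k s'. grown s s' \<and> (\<forall>i < k. col (Leaf i) \<in> fv.span (basis (row s')))"])
  fix k s1
  assume k: "imem s1 6 0 = k"
    and 1: "grown s s1 \<and> (\<forall>i < k. col (Leaf i) \<in> fv.span (basis (row s1)))"
  show "reach (Seq (sweeps var_update) insert_vec) s1 column_cost
    (\<lambda>s'. imem s' 6 0 = k \<and> grown s (iupdate 6 0 (Suc k) s') \<and>
      (\<forall>i < Suc k. col (Leaf i) \<in> fv.span (basis (row (iupdate 6 0 (Suc k) s')))))"
  proof (rule reach_mono[OF reach_var_column order_refl])
    show "env s1" "echelon (row s1)" "imem s1 6 0 = k"
      using 1 k env grown_env[of s s1] by (auto simp: grown_def)
    fix s2 assume 2: "grown s1 s2 \<and> imem s2 6 = imem s1 6 \<and> imem s2 7 = imem s1 7 \<and>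
      col (Leaf k) \<in> fv.span (basis (row s2))"
    show "imem s2 6 0 = k \<and> grown s (iupdate 6 0 (Suc k) s2) \<and>
      (\<forall>i < Suc k. col (Leaf i) \<in> fv.span (basis (row (iupdate 6 0 (Suc k) s2))))"
    proof (intro conjI allI impI)
      show "grown s (iupdate 6 0 (Suc k) s2)"
        using 1 2 grown_trans[of s s1 s2] by (simp add: grown_iupdate)
      fix i assume "i < Suc k"
      then show "col (Leaf i) \<in> fv.span (basis (row (iupdate 6 0 (Suc k) s2)))"
        using 1 2 grown_span[of s1 s2 "col (Leaf i)"] by (cases "i = k") auto
    qed (use 2 k in simp)
  qed
qed (use env ech grown_env in \<open>auto simp: env_def input_def grown_def same_except_def\<close>)

text \<open>\<open>R\<close> is frozen while the stored rows grow. Pivot rows never change, so the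
  rows read by the loop agree with \<open>R\<close> at its pivots, and products already in the span
  remain there.\<close>

lemma reach_node_loop:
  assumes env: "env s" and ech: "echelon (row s)" and R: "extends R (row s)"
  shows "reach (For 6 nodes (For 7 nodes (Seq (sweeps node_update) insert_vec))) s
    (loop_cost M (loop_cost M column_cost))
    (\<lambda>s'. grown s s' \<and> (\<forall>p \<in> pivots R. \<forall>q \<in> pivots R. bprod (R p) (R q) \<in> fv.span (basis (row s'))))"
proof (rule reach_For[where N = size and
      I = "\<lambda>k s'. grown s s' \<and> (\<forall>p \<in> pivots R. \<forall>q \<in> pivots R. p < k \<longrightarrow>
        bprod (R p) (R q) \<in> fv.span (basis (row s')))"])
  fix k s1
  assume k: "k < size" "imem s1 6 0 = k"
    and 1: "grown s s1 \<and> (\<forall>p \<in> pivots R. \<forall>q \<in> pivots R. p < k \<longrightarrow>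
        bprod (R p) (R q) \<in> fv.span (basis (row s1)))"
  show "reach (For 7 nodes (Seq (sweeps node_update) insert_vec)) s1 (loop_cost M column_cost)
    (\<lambda>s'. imem s' 6 0 = k \<and> grown s (iupdate 6 0 (Suc k) s') \<and>
      (\<forall>p \<in> pivots R. \<forall>q \<in> pivots R. p < Suc k \<longrightarrow>
        bprod (R p) (R q) \<in> fv.span (basis (row (iupdate 6 0 (Suc k) s')))))"
  proof (rule reach_For[where N = size and
      I = "\<lambda>j s'. imem s' 6 0 = k \<and> grown s s' \<and> (\<forall>p \<in> pivots R. \<forall>q \<in> pivots R.
        p < k \<or> p = k \<and> q < j \<longrightarrow> bprod (R p) (R q) \<in> fv.span (basis (row s')))"])
    fix j s2
    assume j: "j < size" "imem s2 7 0 = j"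
      and 2: "imem s2 6 0 = k \<and> grown s s2 \<and> (\<forall>p \<in> pivots R. \<forall>q \<in> pivots R.
        p < k \<or> p = k \<and> q < j \<longrightarrow> bprod (R p) (R q) \<in> fv.span (basis (row s2)))"
    have R2: "extends R (row s2)"
      using 2 extends_trans[OF R] by (simp add: grown_def)
    show "reach (Seq (sweeps node_update) insert_vec) s2 column_cost
      (\<lambda>s'. imem s' 7 0 = j \<and> imem (iupdate 7 0 (Suc j) s') 6 0 = k \<and> grown s (iupdate 7 0 (Suc j) s') \<and>
        (\<forall>p \<in> pivots R. \<forall>q \<in> pivots R. p < k \<or> p = k \<and> q < Suc j \<longrightarrow>
          bprod (R p) (R q) \<in> fv.span (basis (row (iupdate 7 0 (Suc j) s')))))"
    proof (rule reach_mono[OF reach_node_column order_refl])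
      show "env s2" "echelon (row s2)" "imem s2 6 0 = k" "k < size" "imem s2 7 0 = j" "j < size"
        using 2 k j env grown_env[of s s2] by (auto simp: grown_def)
      fix s3 assume 3: "grown s2 s3 \<and> imem s3 6 = imem s2 6 \<and> imem s3 7 = imem s2 7 \<and>
        bprod (row s2 k) (row s2 j) \<in> fv.span (basis (row s3))"
      show "imem s3 7 0 = j \<and> imem (iupdate 7 0 (Suc j) s3) 6 0 = k \<and> grown s (iupdate 7 0 (Suc j) s3) \<and>
        (\<forall>p \<in> pivots R. \<forall>q \<in> pivots R. p < k \<or> p = k \<and> q < Suc j \<longrightarrow>
          bprod (R p) (R q) \<in> fv.span (basis (row (iupdate 7 0 (Suc j) s3))))"
      proof (intro conjI ballI impI)
        show "grown s (iupdate 7 0 (Suc j) s3)"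
          using 2 3 grown_trans[of s s2 s3] by (simp add: grown_iupdate)
        fix p q assume pq: "p \<in> pivots R" "q \<in> pivots R" "p < k \<or> p = k \<and> q < Suc j"
        show "bprod (R p) (R q) \<in> fv.span (basis (row (iupdate 7 0 (Suc j) s3)))"
        proof (cases "p = k \<and> q = j")
          case True
          then show ?thesis
            using 3 R2 pq by (simp add: extends_def)
        next
          case False
          then have "bprod (R p) (R q) \<in> fv.span (basis (row s2))"
            using 2 pq less_Suc_eq by blast
          then show ?thesis
            using 3 grown_span[of s2 s3] by simp
        qed
      qed (use 2 3 j in simp_all)
    qed
  next
    fix s' assume *: "imem s' 6 0 = k \<and> grown s s' \<and> (\<forall>p \<in> pivots R. \<forall>q \<in> pivots R.
        p < k \<or> p = k \<and> q < size \<longrightarrow> bprod (R p) (R q) \<in> fv.span (basis (row s')))"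
    moreover have "q < size" if "q \<in> pivots R" for q
      using that by (simp add: pivots_def)
    ultimately show "imem s' 6 0 = k \<and> grown s (iupdate 6 0 (Suc k) s') \<and>
      (\<forall>p \<in> pivots R. \<forall>q \<in> pivots R. p < Suc k \<longrightarrow>
        bprod (R p) (R q) \<in> fv.span (basis (row (iupdate 6 0 (Suc k) s'))))"
      by (simp add: grown_iupdate less_Suc_eq)
  next
    show "ival nodes s' = size" if "imem s' 6 0 = k \<and> grown s s' \<and> (\<forall>p \<in> pivots R. \<forall>q \<in> pivots R.
        p < k \<or> p = k \<and> q < j \<longrightarrow> bprod (R p) (R q) \<in> fv.span (basis (row s')))" for j s'
      using that env grown_env[of s s'] by (simp add: env_def input_def)
  qed (use 1 k in \<open>simp_all add: grown_iupdate\<close>)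
next
  show "ival nodes s' = size" if "grown s s' \<and> (\<forall>p \<in> pivots R. \<forall>q \<in> pivots R. p < k \<longrightarrow>
        bprod (R p) (R q) \<in> fv.span (basis (row s')))" for k s'
    using that env grown_env[of s s'] by (simp add: env_def input_def)
qed (use ech in \<open>auto simp: pivots_def grown_def intro: same_except_iupdate\<close>)

lemma reach_one_round:
  assumes env: "env s" and ech: "echelon (row s)"
    and r: "complete (row s) \<or> r \<le> card (pivots (row s))"
  shows "reach one_round s round_cost
    (\<lambda>s'. grown s s' \<and> (complete (row s') \<or> Suc r \<le> card (pivots (row s'))))"
  unfolding one_round_def round_cost_def
proof (rule reach_Seq[OF reach_mono[OF reach_leaf_loop[OF env ech] order_refl]])
  fix s1 assume 1: "grown s s1 \<and> (\<forall>i < n. col (Leaf i) \<in> fv.span (basis (row s1)))"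
  show "reach (For 6 nodes (For 7 nodes (Seq (sweeps node_update) insert_vec))) s1
      (loop_cost M (loop_cost M column_cost))
    (\<lambda>s'. grown s s' \<and> (complete (row s') \<or> Suc r \<le> card (pivots (row s'))))"
  proof (rule reach_mono[OF reach_node_loop order_refl])
    show "env s1" "echelon (row s1)" "extends (row s) (row s1)"
      using 1 env grown_env[of s s1] by (auto simp: grown_def)
    fix s2 assume 2: "grown s1 s2 \<and> (\<forall>p \<in> pivots (row s). \<forall>q \<in> pivots (row s).
      bprod (row s p) (row s q) \<in> fv.span (basis (row s2)))"
    have g: "grown s s2"
      using 1 2 grown_trans by blast
    have "complete (row s2) \<or> Suc r \<le> card (pivots (row s2))"
    proof (rule round_progress)
      show "extends (row s) (row s2)"
        using g by (simp add: grown_def)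
      show "col (Leaf i) \<in> fv.span (basis (row s2))" if "i < n" for i
        using 1 2 that grown_span[of s1 s2] by blast
    qed (use 2 r in blast)+
    with g show "grown s s2 \<and> (complete (row s2) \<or> Suc r \<le> card (pivots (row s2)))" ..
  qed
qed simp

lemma reach_rounds:
  assumes env: "env s" and ech: "echelon (row s)"
  shows "reach (For 5 (IAdd nodes (INum 1)) one_round) s (loop_cost M round_cost)
    (\<lambda>s'. env s' \<and> echelon (row s') \<and> complete (row s'))"
proof (rule reach_For[where N = "Suc size" and
      I = "\<lambda>r s'. env s' \<and> echelon (row s') \<and> (complete (row s') \<or> r \<le> card (pivots (row s')))"])
  fix r s1
  assume r: "imem s1 5 0 = r"
    and 1: "env s1 \<and> echelon (row s1) \<and> (complete (row s1) \<or> r \<le> card (pivots (row s1)))"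
  show "reach one_round s1 round_cost (\<lambda>s'. imem s' 5 0 = r \<and> env (iupdate 5 0 (Suc r) s') \<and>
     echelon (row (iupdate 5 0 (Suc r) s')) \<and>
     (complete (row (iupdate 5 0 (Suc r) s')) \<or> Suc r \<le> card (pivots (row (iupdate 5 0 (Suc r) s')))))"
  proof (rule reach_mono[OF reach_one_round order_refl])
    fix s2 assume 2: "grown s1 s2 \<and> (complete (row s2) \<or> Suc r \<le> card (pivots (row s2)))"
    then have "env s2" "imem s2 5 = imem s1 5"
      using 1 grown_env[of s1 s2] by (auto simp: grown_def same_except_def)
    then show "imem s2 5 0 = r \<and> env (iupdate 5 0 (Suc r) s2) \<and>
     echelon (row (iupdate 5 0 (Suc r) s2)) \<and>
     (complete (row (iupdate 5 0 (Suc r) s2)) \<or> Suc r \<le> card (pivots (row (iupdate 5 0 (Suc r) s2))))"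
      using 2 r by (simp add: grown_def env_def input_def)
  qed (use 1 in auto)
next
  fix s' assume "env s' \<and> echelon (row s') \<and> (complete (row s') \<or> Suc size \<le> card (pivots (row s')))"
  then show "env s' \<and> echelon (row s') \<and> complete (row s')"
    using card_pivots[of "row s'"] by auto
qed (use env ech in \<open>auto simp: env_def input_def\<close>)

section \<open>The decision and the whole program\<close>

lemma reach_decide:
  assumes env: "env s" and f: "circuit_computes C f" and R: "echelon (row s)" "complete (row s)"
  shows "reach decide s (loop_cost M 60 + 60) (\<lambda>s'. answer s' = (if f = 0 then 1 else 0))"
proof -
  let ?o = "output_node C"
  have o: "?o < size"
    using wf by (simp add: wf_circuit_def size_def)
  let ?ok = "\<lambda>k. cst ?o = 0 \<and> (\<forall>p < k. row s p ?o = 0)"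
  \<comment> \<open>Array 0 receives the answer and is thus exempt from the frame condition; the
    cells still to be read are listed explicitly.\<close>
  let ?I = "\<lambda>k s'. same_except {0, 6} {} s s' \<and> imem s' 0 (Suc 0) = size \<and> imem s' 0 2 = ?o \<and>
    imem s' 0 0 = (if ?ok k then 1 else 0)"
  have input: "imem s 0 (Suc 0) = size" "imem s 0 2 = ?o" "fmem s 1 ?o = cst ?o"
    "\<And>p. p < size \<Longrightarrow> imem s 4 p = p * size"
    using env o by (auto simp: env_def input_def)
  have loop: "reach (For 6 nodes (If (IsZero (FGet 3 (entry 6 (IGet 0 (INum 2))))) Skip
         (ISet 0 (INum 0) (INum 0)))) s1 (loop_cost M 60) (\<lambda>s'. answer s' = (if f = 0 then 1 else 0))"
    if "?I 0 s1" for s1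
  proof (rule reach_For[where N = size and I = ?I])
    fix k s2 assume k: "k < size" "imem s2 6 0 = k" and 2: "?I k s2"
    then have "fval (FGet 3 (entry 6 (IGet 0 (INum 2)))) s2 = row s k ?o"
      using input o by (simp add: same_except_def row_def)
    then show "reach (If (IsZero (FGet 3 (entry 6 (IGet 0 (INum 2))))) Skip (ISet 0 (INum 0) (INum 0))) s2 60
      (\<lambda>s'. imem s' 6 0 = k \<and> ?I (Suc k) (iupdate 6 0 (Suc k) s'))"
      using 2 k
      by (intro reach_If reach_Skip reach_ISet) (auto simp: less_Suc_eq intro!: same_except_iupdate)
  qed (use that zero_iff[OF f R] in \<open>auto simp: answer_def intro: same_except_iupdate\<close>)
  let ?s1 = "iupdate 0 0 1 s"
  have "reach (Seq (If (IsZero (FGet 1 (IGet 0 (INum 2)))) Skip (ISet 0 (INum 0) (INum 0)))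
       (For 6 nodes (If (IsZero (FGet 3 (entry 6 (IGet 0 (INum 2))))) Skip
         (ISet 0 (INum 0) (INum 0))))) ?s1 (30 + loop_cost M 60) (\<lambda>s'. answer s' = (if f = 0 then 1 else 0))"
  proof (rule reach_Seq[OF reach_mono[OF _ order_refl loop]])
    show "reach (If (IsZero (FGet 1 (IGet 0 (INum 2)))) Skip (ISet 0 (INum 0) (INum 0))) ?s1 30 (?I 0)"
      using input by (intro reach_If reach_Skip reach_ISet) (auto intro!: same_except_iupdate)
  qed auto
  then show ?thesis
    unfolding decide_def by (intro reach_Seq[where ?T1.0 = 20, OF reach_ISet]) auto
qed

lemma input_input_state: "input (input_state n C)"
  by (auto simp: input_def input_state_def array_of_def size_def circuit_size_def)

text \<open>Offset 0 is the initial content of the cell. Pass \<open>k\<close> writes offset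
  \<open>k + 1\<close>, hence \<open>p \<le> k\<close> in the invariant.\<close>

lemma reach_row_offsets:
  assumes "input s" "imem s 4 0 = 0"
  shows "reach row_offsets s (loop_cost M 40)
    (\<lambda>s'. same_except {4, 6} {} s s' \<and> (\<forall>p < size. imem s' 4 p = p * size))"
  unfolding row_offsets_def
  by (rule reach_For[where N = size and
        I = "\<lambda>k s'. same_except {4, 6} {} s s' \<and> (\<forall>p \<le> k. imem s' 4 p = p * size)"])
     (use assms in \<open>auto simp: input_def same_except_def le_Suc_eq intro!: reach_ISet\<close>)

definition zero_test_cost :: nat where
  "zero_test_cost = loop_cost M 40 +
     (loop_cost M (loop_cost M 150) + (loop_cost M round_cost + (loop_cost M 60 + 60)))"

lemma reach_zero_test:
  assumes f: "circuit_computes C f"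
  shows "reach zero_test (input_state n C) zero_test_cost (\<lambda>s. answer s = (if f = 0 then 1 else 0))"
  unfolding zero_test_def zero_test_cost_def
proof (rule reach_Seq[OF reach_mono[OF reach_row_offsets order_refl] order_refl])
  let ?s = "input_state n C"
  show "input ?s" "imem ?s 4 0 = 0"
    by (rule input_input_state) (simp add: input_state_def)
  fix s1 assume 1: "same_except {4, 6} {} ?s s1 \<and> (\<forall>p < size. imem s1 4 p = p * size)"
  then have input1: "input s1"
    using input_same[of "{4, 6}" "{}" ?s s1] input_input_state by simp
  show "reach (Seq (sweeps cst_update) (Seq (For 5 (IAdd nodes (INum 1)) one_round) decide)) s1
    (loop_cost M (loop_cost M 150) + (loop_cost M round_cost + (loop_cost M 60 + 60)))
    (\<lambda>s. answer s = (if f = 0 then 1 else 0))"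
  proof (rule reach_Seq[OF reach_mono[OF reach_sweeps[OF local_cst_rhs cst_eq] order_refl] order_refl])
    show "imem s1 0 (Suc 0) = size"
      using input1 by (simp add: input_def)
    show "reach cst_update s' 150 (\<lambda>s''. s'' = fupdate 1 g (cst_rhs g (fmem s' 1)) s')"
      if "same_except {8, 9} {1} s1 s'" "g < size" "imem s' 9 0 = g" for s' :: "'a state" and g
      using that input1 input_same[of "{8, 9}" "{1}" s1 s'] by (intro reach_cst_update) simp_all
    fix s2 assume 2: "same_except {8, 9} {1} s1 s2 \<and> (\<forall>g < size. fmem s2 1 g = cst g)"
    then have env2: "env s2"
      using 1 input1 input_same[of "{8, 9}" "{1}" s1 s2] by (auto simp: env_def same_except_def)
    \<comment> \<open>The array of rows is still in its initial zero state, so elimination starts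
      without pivots.\<close>
    have "row s2 p = 0" for p
      using 1 2 by (auto simp: row_def fun_eq_iff same_except_def input_state_def)
    then have ech2: "echelon (row s2)"
      by (simp add: echelon_def fv.span_zero)
    show "reach (Seq (For 5 (IAdd nodes (INum 1)) one_round) decide) s2
      (loop_cost M round_cost + (loop_cost M 60 + 60)) (\<lambda>s. answer s = (if f = 0 then 1 else 0))"
      by (rule reach_Seq[OF reach_mono[OF reach_rounds[OF env2 ech2] order_refl] order_refl])
         (use reach_decide f in blast)
  qed
qed

end

section \<open>Polynomial bounds\<close>

definition poly_bounded :: "(nat \<Rightarrow> nat) \<Rightarrow> bool" where
  "poly_bounded F \<longleftrightarrow> (\<exists>c k. \<forall>m \<ge> 1. F m \<le> c * m ^ k)"

lemma poly_bounded_const: "poly_bounded (\<lambda>_. a)"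
  unfolding poly_bounded_def by (intro exI[of _ a] exI[of _ 0]) simp

lemma poly_bounded_id: "poly_bounded (\<lambda>m. m)"
  unfolding poly_bounded_def by (intro exI[of _ 1]) simp

lemma poly_bounded_mult:
  assumes "poly_bounded F" "poly_bounded G" shows "poly_bounded (\<lambda>m. F m * G m)"
proof -
  obtain c k c' k' where "\<forall>m \<ge> 1. F m \<le> c * m ^ k" "\<forall>m \<ge> 1. G m \<le> c' * m ^ k'"
    using assms unfolding poly_bounded_def by blast
  then have "F m * G m \<le> (c * c') * m ^ (k + k')" if "m \<ge> 1" for m
    using mult_mono[of "F m" "c * m ^ k" "G m" "c' * m ^ k'"] that by (simp add: power_add mult_ac)
  then show ?thesis
    unfolding poly_bounded_def by blast
qed

text \<open>For \<open>m \<ge> 1\<close> both powers are at most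
  \<open>m ^ (k + k')\<close>.\<close>

lemma poly_bounded_add:
  assumes "poly_bounded F" "poly_bounded G" shows "poly_bounded (\<lambda>m. F m + G m)"
proof -
  obtain c k c' k' where *: "\<forall>m \<ge> 1. F m \<le> c * m ^ k" "\<forall>m \<ge> 1. G m \<le> c' * m ^ k'"
    using assms unfolding poly_bounded_def by blast
  have "F m + G m \<le> (c + c') * m ^ (k + k')" if "m \<ge> 1" for m
  proof -
    have "c * m ^ k \<le> c * m ^ (k + k')" "c' * m ^ k' \<le> c' * m ^ (k + k')"
      using that by (auto intro!: mult_left_mono power_increasing)
    moreover have "F m \<le> c * m ^ k" "G m \<le> c' * m ^ k'"
      using * that by simp_all
    ultimately show ?thesis
      unfolding add_mult_distrib by linarith
  qed
  then show ?thesis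
    unfolding poly_bounded_def by blast
qed

lemma poly_bounded_loop_cost: "poly_bounded F \<Longrightarrow> poly_bounded (\<lambda>m. loop_cost m (F m))"
  unfolding loop_cost_def
  by (intro poly_bounded_mult poly_bounded_add poly_bounded_const poly_bounded_id)

theorem theorem1:
  "\<exists>(P :: com) (c :: nat) (k :: nat).
     \<forall>(n :: nat) (C :: 'a::field circuit) (f :: 'a npoly).
       wf_circuit n C \<and> circuit_computes C f \<longrightarrow>
       (\<exists>t s. runs P (input_state n C) t s \<and>
              t \<le> c * (circuit_size C + n + npoly_degree f) ^ k \<and>
              answer s = (if f = 0 then 1 else 0))"
proof -
  \<comment> \<open>The constants must be chosen before the circuit, so the costs are restated as
    functions of the bound \<open>m\<close> alone.\<close>
  define ins where "ins m = loop_cost m (2 * loop_cost m 40 + 50)" for m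
  define column where "column m = loop_cost m (loop_cost m 150) + ins m" for m
  define round where "round m = loop_cost m (column m) + loop_cost m (loop_cost m (column m))" for m
  define total where "total m = loop_cost m 40 +
     (loop_cost m (loop_cost m 150) + (loop_cost m (round m) + (loop_cost m 60 + 60)))" for m
  have "poly_bounded total"
    unfolding total_def[abs_def] round_def column_def ins_def
    by (intro poly_bounded_add poly_bounded_mult poly_bounded_loop_cost poly_bounded_const)
  then obtain c k where ck: "\<And>m. m \<ge> 1 \<Longrightarrow> total m \<le> c * m ^ k"
    unfolding poly_bounded_def by blast
  show ?thesis
  proof (rule exI[of _ zero_test], rule exI[of _ "c * 2 ^ k"], rule exI[of _ k], intro allI impI)
    fix n and C :: "'a circuit" and f :: "'a npoly"
    assume C: "wf_circuit n C \<and> circuit_computes C f"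
    interpret circuit n C
      by unfold_locales (use C in simp)
    let ?N = "circuit_size C + n + npoly_degree f"
    obtain t s where ts: "runs zero_test (input_state n C) t s" "t \<le> zero_test_cost"
        "answer s = (if f = 0 then 1 else 0)"
      using reach_zero_test C unfolding reach_def by blast
    have "zero_test_cost = total M"
      by (simp add: zero_test_cost_def total_def round_cost_def round_def column_cost_def column_def
          insert_cost_def ins_def)
    also have "\<dots> \<le> c * M ^ k"
      by (rule ck) (simp add: M_def)
    \<comment> \<open>The output node exists, so \<open>size\<close> is at least 1 and
      \<open>M = size + n + 1\<close> is at most \<open>2 * ?N\<close>. This is the origin of the
      factor \<open>2 ^ k\<close>.\<close>
    also have "\<dots> \<le> c * (2 * ?N) ^ k"
      using C by (intro mult_left_mono power_mono) (auto simp: M_def size_def wf_circuit_def)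
    also have "\<dots> = (c * 2 ^ k) * ?N ^ k"
      by (simp only: power_mult_distrib mult.assoc)
    finally have "t \<le> (c * 2 ^ k) * ?N ^ k"
      by (rule le_trans[OF ts(2)])
    with ts show "\<exists>t s. runs zero_test (input_state n C) t s \<and>
        t \<le> (c * 2 ^ k) * ?N ^ k \<and> answer s = (if f = 0 then 1 else 0)"
      by blast
  qed
qed

end
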